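(* Let $\kappa$ be a regular uncountable cardinal and $\chi<\kappa$ a cardinal such that $\lambda^{<\chi}<\kappa$ for all $\lambda<\kappa$ and $\mathrm{P}_{14}(\kappa,\sqsubseteq,\kappa,\{E^\kappa_{\ge\chi}\})$ holds. Then there exists a downward-closed $T\subseteq{}^{<\kappa}\kappa$ which is a prolific slim $\chi$-free $\kappa$-Souslin tree.
   Context: Downward-closed subsets of ${}^{<\kappa}\kappa$ are ordered by $\subsetneq$, height $=\mathrm{dom}$, $T_\alpha=T\cap{}^\alpha\kappa$. Prolific: $x^\frown\langle i\rangle\in T$ for $x\in T_\alpha$, $i<\max\{\omega,\alpha\}$. Slim: $|T_\alpha|\le\max\{|\alpha|,\aleph_0\}$. $\kappa$-Souslin: height $\kappa$, levels of size $<\kappa$, no cofinal branch, no antichain of size $\kappa$. $T^\tau=\{f:\tau\to T\mid\mathrm{ht}\circ f$ constant$\}$; for nonzero $\tau$, $\beta<\kappa$ and distinct $\langle w_i\mid i<\tau\rangle\in{}^\tau T_\beta$, the derived tree $\bigotimes_{i<\tau}w_i^\uparrow$ is the set of $f\in T^\tau$ with each $f(i)$ compatible with $w_i$, ordered by $f<g$ iff $f(i)\subsetneq g(i)$ for all $i$. $T$ is $\chi$-free if all such derived trees with $0<\tau<\chi$ are $\kappa$-Souslin. $E^\kappa_{\ge\chi}=\{\alpha<\kappa\mid\mathrm{cf}(\alpha)\ge\chi\}$. $\mathrm{P}_{14}(\kappa,\sqsubseteq,\kappa,\{S\})$: $\diamondsuit(\kappa)$ holds and there is $\langle C_\alpha\mid\alpha<\kappa\rangle$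 with $C_\alpha$ club in $\alpha$ for limit $\alpha$, $C_{\bar\alpha}=C_\alpha\cap\bar\alpha$ for $\bar\alpha\in\mathrm{acc}(C_\alpha)=\{\gamma\in C_\alpha\mid\sup(C_\alpha\cap\gamma)=\gamma>0\}$, and for every sequence $\langle A_i\mid i<\kappa\rangle$ of cofinal subsets of $\kappa$ there are stationarily many $\alpha\in S$ with $\sup\{\beta\in C_\alpha\mid\mathrm{succ}_\omega(C_\alpha\setminus\beta)\subseteq A_i\}=\alpha$ for all $i<\alpha$, where $\mathrm{succ}_\omega(D)=\{\delta\in D\mid0<\mathrm{otp}(D\cap\delta)<\omega\}$. *)

theory Defs
  imports Main "HOL-Library.Equipollence" "HOL-Library.FuncSet"
begin

text \<open>Convention: the regular uncountable cardinal kappa is represented by a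
well-ordered type 'k, whose elements are the ordinals below kappa (the order type
of UNIV :: 'k set is kappa). Sequences in the set of all x : alpha -> kappa with
alpha < kappa are represented as pairs (alpha, f) with f extensional on alpha.\<close>

type_synonym 'k kseq = "'k \<times> ('k \<Rightarrow> 'k)"

definition oless :: "'k::wellorder \<Rightarrow> 'k set" where
  "oless a = {b. b < a}"

definition ozero :: "'k::wellorder" where
  "ozero = (LEAST x. True)"

definition osucc :: "'k::wellorder \<Rightarrow> 'k" where
  "osucc a = (LEAST b. a < b)"

definition oomega :: "'k::wellorder" where
  "oomega = (LEAST b. infinite (oless b))"

definition is_sup :: "'k::wellorder set \<Rightarrow> 'k \<Rightarrow> bool" where
  "is_sup X a \<longleftrightarrow> (\<forall>x\<in>X. x \<le> a) \<and> (\<forall>b<a. \<exists>x\<in>X. b < x)"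

definition is_limit :: "'k::wellorder \<Rightarrow> bool" where
  "is_limit a \<longleftrightarrow> ozero < a \<and> (\<forall>b<a. osucc b < a)"

definition regular_uncountable_cardinal_type :: "'k::wellorder itself \<Rightarrow> bool" where
  "regular_uncountable_cardinal_type _ \<longleftrightarrow>
     (\<forall>a::'k. oless a \<prec> (UNIV :: 'k set)) \<and>
     (\<forall>X::'k set. (\<forall>a. \<exists>x\<in>X. a \<le> x) \<longrightarrow> X \<approx> (UNIV :: 'k set)) \<and>
     \<not> countable (UNIV :: 'k set)"

definition is_cardinal :: "'k::wellorder \<Rightarrow> bool" where
  "is_cardinal c \<longleftrightarrow> (\<forall>b<c. oless b \<prec> oless c)"

definition seqs_below :: "'k::wellorder \<Rightarrow> 'k \<Rightarrow> ('k \<times> ('k \<Rightarrow> 'k)) set" where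
  "seqs_below l c = {(m, f). m < c \<and> f \<in> oless m \<rightarrow>\<^sub>E oless l}"

text \<open>cf(alpha) >= chi, with chi a cardinal\<close>
definition cf_ge :: "'k::wellorder \<Rightarrow> 'k \<Rightarrow> bool" where
  "cf_ge a c \<longleftrightarrow> (\<forall>X. X \<subseteq> oless a \<and> is_sup X a \<longrightarrow> \<not> X \<prec> oless c)"

definition E_ge :: "'k::wellorder \<Rightarrow> 'k set" where
  "E_ge c = {a. cf_ge a c}"

definition club :: "'k::wellorder set \<Rightarrow> bool" where
  "club C \<longleftrightarrow> (\<forall>a. \<exists>c\<in>C. a \<le> c) \<and>
     (\<forall>a. ozero < a \<and> is_sup (C \<inter> oless a) a \<longrightarrow> a \<in> C)"

definition stationary :: "'k::wellorder set \<Rightarrow> bool" where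
  "stationary S \<longleftrightarrow> (\<forall>C. club C \<longrightarrow> S \<inter> C \<noteq> {})"

definition club_in :: "'k::wellorder set \<Rightarrow> 'k \<Rightarrow> bool" where
  "club_in C a \<longleftrightarrow> C \<subseteq> oless a \<and> (\<forall>b<a. \<exists>c\<in>C. b \<le> c) \<and>
     (\<forall>g<a. ozero < g \<and> is_sup (C \<inter> oless g) g \<longrightarrow> g \<in> C)"

definition acc :: "'k::wellorder set \<Rightarrow> 'k set" where
  "acc C = {g\<in>C. ozero < g \<and> is_sup (C \<inter> oless g) g}"

text \<open>succ_omega(D): elements delta of D with 0 < otp(D \<inter> delta) < omega\<close>
definition succ_omega :: "'k::wellorder set \<Rightarrow> 'k set" where
  "succ_omega D = {d\<in>D. D \<inter> oless d \<noteq> {} \<and> finite (D \<inter> oless d)}"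

definition diamond :: "'k::wellorder itself \<Rightarrow> bool" where
  "diamond _ \<longleftrightarrow> (\<exists>A :: 'k \<Rightarrow> 'k set. (\<forall>a. A a \<subseteq> oless a) \<and>
     (\<forall>X. stationary {a. X \<inter> oless a = A a}))"

definition P14 :: "'k::wellorder set \<Rightarrow> bool" where
  "P14 S \<longleftrightarrow> diamond TYPE('k) \<and>
    (\<exists>C :: 'k \<Rightarrow> 'k set.
       (\<forall>a. is_limit a \<longrightarrow> club_in (C a) a) \<and>
       (\<forall>a. \<forall>a'\<in>acc (C a). C a' = C a \<inter> oless a') \<and>
       (\<forall>A :: 'k \<Rightarrow> 'k set. (\<forall>i. \<forall>b. \<exists>x\<in>A i. b \<le> x) \<longrightarrow>
          stationary {a\<in>S. \<forall>i<a.
             is_sup {b\<in>C a. succ_omega {c\<in>C a. b \<le> c} \<subseteq> A i} a}))"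

definition is_seq :: "'k::wellorder kseq \<Rightarrow> bool" where
  "is_seq x \<longleftrightarrow> snd x \<in> oless (fst x) \<rightarrow>\<^sub>E UNIV"

definition sq_less :: "'k::wellorder kseq \<Rightarrow> 'k kseq \<Rightarrow> bool" where
  "sq_less x y \<longleftrightarrow> fst x < fst y \<and> (\<forall>b<fst x. snd x b = snd y b)"

definition compat :: "'k::wellorder kseq \<Rightarrow> 'k kseq \<Rightarrow> bool" where
  "compat x y \<longleftrightarrow> x = y \<or> sq_less x y \<or> sq_less y x"

definition downward_closed_tree :: "'k::wellorder kseq set \<Rightarrow> bool" where
  "downward_closed_tree T \<longleftrightarrow> (\<forall>x\<in>T. is_seq x) \<and>
     (\<forall>x\<in>T. \<forall>y. is_seq y \<and> sq_less y x \<longrightarrow> y \<in> T)"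

definition level :: "'k::wellorder kseq set \<Rightarrow> 'k \<Rightarrow> 'k kseq set" where
  "level T a = {x\<in>T. fst x = a}"

definition concat1 :: "'k::wellorder kseq \<Rightarrow> 'k \<Rightarrow> 'k kseq" where
  "concat1 x i = (osucc (fst x), (snd x)(fst x := i))"

definition prolific :: "'k::wellorder kseq set \<Rightarrow> bool" where
  "prolific T \<longleftrightarrow> (\<forall>x\<in>T. \<forall>i. i < max oomega (fst x) \<longrightarrow> concat1 x i \<in> T)"

definition slim :: "'k::wellorder kseq set \<Rightarrow> bool" where
  "slim T \<longleftrightarrow> (\<forall>a. level T a \<lesssim> oless a \<or> countable (level T a))"

definition souslin :: "'a set \<Rightarrow> ('a \<Rightarrow> 'a \<Rightarrow> bool) \<Rightarrow> ('a \<Rightarrow> 'k::wellorder) \<Rightarrow> bool" where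
  "souslin A r h \<longleftrightarrow>
     (\<forall>a::'k. \<exists>x\<in>A. a \<le> h x) \<and>
     (\<forall>a::'k. {x\<in>A. h x = a} \<prec> (UNIV :: 'k set)) \<and>
     \<not> (\<exists>B\<subseteq>A. (\<forall>x\<in>B. \<forall>y\<in>B. x = y \<or> r x y \<or> r y x) \<and> (\<forall>a::'k. \<exists>x\<in>B. a \<le> h x)) \<and>
     (\<forall>B\<subseteq>A. (\<forall>x\<in>B. \<forall>y\<in>B. x \<noteq> y \<longrightarrow> \<not> r x y \<and> \<not> r y x) \<longrightarrow> B \<prec> (UNIV :: 'k set))"

definition derived_tree :: "'k::wellorder kseq set \<Rightarrow> 'k \<Rightarrow> ('k \<Rightarrow> 'k kseq) \<Rightarrow> ('k \<Rightarrow> 'k kseq) set" where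
  "derived_tree T t w = {f. f \<in> oless t \<rightarrow>\<^sub>E T \<and> (\<exists>g. \<forall>i<t. fst (f i) = g) \<and>
      (\<forall>i<t. compat (f i) (w i))}"

definition derived_less :: "'k::wellorder \<Rightarrow> ('k \<Rightarrow> 'k kseq) \<Rightarrow> ('k \<Rightarrow> 'k kseq) \<Rightarrow> bool" where
  "derived_less t f g \<longleftrightarrow> (\<forall>i<t. sq_less (f i) (g i))"

definition derived_ht :: "('k::wellorder \<Rightarrow> 'k kseq) \<Rightarrow> 'k" where
  "derived_ht f = fst (f ozero)"

definition chi_free :: "'k::wellorder kseq set \<Rightarrow> 'k \<Rightarrow> bool" where
  "chi_free T c \<longleftrightarrow> (\<forall>t b w. ozero < t \<and> t < c \<and> (\<forall>i<t. w i \<in> level T b) \<and>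
      inj_on w (oless t) \<longrightarrow>
      souslin (derived_tree T t w) (derived_less t) derived_ht)"

end

theory Submission
  imports Defs
begin

text \<open>
  The tree is built level by level. Successor levels are full; at a limit \<open>a\<close> one keeps only the
  limits of canonical branches, one for every node \<open>x\<close> whose height lies in \<open>C a\<close>: the branch
  climbs through the levels in \<open>C a\<close>, and coherence of \<open>C\<close> puts its nodes at accumulation points of
  \<open>C a\<close> back into the tree. This keeps the tree slim. At a non-accumulation point \<open>b\<close> of \<open>C a\<close> the
  diamond sequence guesses a tuple of nodes \<open>x\<close> and an initial part of a dense open set \<open>U\<close> of a
  derived tree, and the branches from the nodes of the tuple are extended simultaneously so that,
  at level \<open>b\<close>, they form an element above a member of \<open>U\<close>.

  Given a derived tree and a dense open \<open>U\<close>, let \<open>H i\<close> be the set of levels where the guess for \<open>U\<close>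
  and the tuple with code \<open>i\<close> is correct. Take \<open>a\<close> of cofinality at least \<open>c\<close> such that every \<open>H i\<close>
  with \<open>i < a\<close> is hit cofinally by \<open>C a\<close>. Fewer than \<open>c\<close> branches through level \<open>a\<close> are determined
  by a tuple on one level below \<open>a\<close>, hence all tuples on level \<open>a\<close> lie in \<open>U\<close>. Applied to the set of
  elements that are above some member of an antichain or below none, this bounds the heights
  of the antichain. The tree itself is treated as a derived tree with \<open>t = 1\<close>.
\<close>

section \<open>Regular uncountable well-orders\<close>

lemma ozero_le [simp]: "ozero \<le> (a::'k::wellorder)"
  unfolding ozero_def by (rule Least_le) simp

lemma not_less_ozero [simp]: "\<not> a < (ozero::'k::wellorder)"
  by (simp add: not_less)

lemma is_sup_osucc_less:
  assumes "is_sup (X \<inter> oless a) a" "b < (a::'k::wellorder)"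
  shows "osucc b < a"
proof -
  obtain x where "x \<in> X" "x < a" "b < x" using assms by (auto simp: is_sup_def oless_def)
  then show ?thesis unfolding osucc_def by (meson Least_le le_less_trans)
qed

lemma PiE_oless: "f \<in> oless t \<rightarrow>\<^sub>E S \<Longrightarrow> j < t \<Longrightarrow> f j \<in> S"
  by (auto simp: oless_def)

lemma times_self_lepoll: "infinite A \<Longrightarrow> A \<times> A \<lesssim> A"
  using card_of_Times_same_infinite[of A] eqpoll_iff_card_of_ordIso eqpoll_imp_lepoll by blast

text \<open>The type variable is instantiated by a well-order of type $\kappa$; the argument of the
  locale only serves to mention it.\<close>

locale regular_kappa =
  fixes ty :: "'k::wellorder itself"
  assumes reg: "regular_uncountable_cardinal_type ty"
begin

section \<open>Small sets: size below kappa and boundedness\<close>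

lemmas reg_unfolded = reg[unfolded regular_uncountable_cardinal_type_def]

lemma oless_small: "oless (a::'k) \<prec> (UNIV :: 'k set)"
  by (rule reg_unfolded[THEN conjunct1, THEN spec])

lemma unbounded_eqpoll:
  fixes X :: "'k set"
  assumes "\<And>a. \<exists>x\<in>X. a \<le> x"
  shows "X \<approx> (UNIV :: 'k set)"
  by (rule reg_unfolded[THEN conjunct2, THEN conjunct1, THEN spec, THEN mp]) (rule allI, rule assms)

lemma uncountable_UNIV: "\<not> countable (UNIV :: 'k set)"
  by (rule reg_unfolded[THEN conjunct2, THEN conjunct2])

lemma infinite_UNIV: "infinite (UNIV :: 'k set)"
  using uncountable_UNIV countable_finite by blast

lemma small_imp_bounded:
  fixes X :: "'k set"
  assumes "X \<prec> (UNIV :: 'k set)"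
  shows "\<exists>a. \<forall>x\<in>X. x < a"
proof (rule ccontr)
  assume "\<nexists>a. \<forall>x\<in>X. x < a"
  then have "\<And>a. \<exists>x\<in>X. a \<le> x" by (meson not_less)
  then show False using unbounded_eqpoll assms by (auto simp: lesspoll_def)
qed

lemma small_subset: "Y \<prec> (UNIV :: 'k set) \<Longrightarrow> X \<subseteq> Y \<Longrightarrow> X \<prec> (UNIV :: 'k set)"
  using lesspoll_trans1 subset_imp_lepoll by blast

lemma small_image: "X \<prec> (UNIV :: 'k set) \<Longrightarrow> f ` X \<prec> (UNIV :: 'k set)"
  using image_lepoll lesspoll_trans1 by blast

lemma small_image_bounded:
  fixes f :: "'a \<Rightarrow> 'k"
  assumes "X \<prec> (UNIV :: 'k set)"
  shows "\<exists>a. \<forall>x\<in>X. f x < a"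
  using small_imp_bounded[OF small_image[OF assms]] by auto

lemma countable_imp_small:
  assumes "countable X"
  shows "X \<prec> (UNIV :: 'k set)"
proof -
  have "X \<lesssim> (UNIV :: nat set)" using assms by (auto simp: countable_def lepoll_def)
  also have "\<dots> \<lesssim> (UNIV :: 'k set)" using infinite_UNIV infinite_le_lepoll by blast
  finally have "X \<lesssim> (UNIV :: 'k set)" .
  moreover have "\<not> X \<approx> (UNIV :: 'k set)"
    using countable_eqpoll[OF assms] eqpoll_sym uncountable_UNIV by blast
  ultimately show ?thesis by (simp add: lepoll_iff_leqpoll)
qed

section \<open>Successors, limits and the first infinite ordinal\<close>

lemma ex_greater: "\<exists>b. (a::'k) < b"
  using small_imp_bounded[of "{a}"] countable_imp_small[of "{a}"] by auto

lemma less_osucc [simp]: "(a::'k) < osucc a"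
  unfolding osucc_def using ex_greater by (rule LeastI_ex)

lemma osucc_le_iff [simp]: "osucc a \<le> (b::'k) \<longleftrightarrow> a < b"
  by (metis Least_le less_osucc less_le_trans osucc_def)

lemma less_osucc_iff [simp]: "b < osucc a \<longleftrightarrow> b \<le> (a::'k)"
  by (meson leD leI osucc_le_iff)

lemma osucc_inject [simp]: "osucc a = osucc b \<longleftrightarrow> a = (b::'k)"
  by (metis less_osucc_iff order_antisym order_refl)

lemma ozero_less_osucc [simp]: "ozero < osucc (a::'k)" by simp

lemma is_limitI: "ozero < (a::'k) \<Longrightarrow> is_sup (X \<inter> oless a) a \<Longrightarrow> is_limit a"
  using is_sup_osucc_less unfolding is_limit_def by blast

lemma not_is_limit_osucc [simp]: "\<not> is_limit (osucc (a::'k))"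
  unfolding is_limit_def by auto

lemma limit_cases:
  obtains "a = (ozero::'k)" | b where "a = osucc b" | "is_limit a"
proof -
  have "\<exists>b. a = osucc b" if ne: "a \<noteq> ozero" and nl: "\<not> is_limit a"
  proof -
    have "ozero < a" using ne by (simp add: order.not_eq_order_implies_strict)
    with nl obtain b where "b < a" "\<not> osucc b < a" using nl unfolding is_limit_def by auto
    then have "a = osucc b" by (simp add: antisym)
    then show ?thesis ..
  qed
  then show thesis using that by blast
qed

text \<open>A finite \<open>oless b\<close> is determined among initial segments by its cardinality.
  As the type is uncountable, some initial segment is therefore infinite, so the
  \<open>LEAST\<close> in \<open>oomega\<close> is attained.\<close>

lemma countable_if_finite_oless:
  assumes "\<And>b. b \<in> X \<Longrightarrow> finite (oless (b::'k))"
  shows "countable X"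
proof -
  have "card (oless a) \<noteq> card (oless b)" if "a \<in> X" "b \<in> X" "a < b" for a b
  proof -
    have "oless a \<subset> oless b" using that by (auto simp: oless_def)
    from psubset_card_mono[OF assms[OF that(2)] this] show ?thesis by simp
  qed
  then have "inj_on (\<lambda>b. card (oless b)) X"
    by (intro inj_onI) (metis neqE)
  then show ?thesis by (rule countableI)
qed

lemma infinite_oomega: "infinite (oless (oomega::'k))"
proof -
  have "\<exists>b::'k. infinite (oless b)"
    using countable_if_finite_oless[of UNIV] uncountable_UNIV by blast
  then show ?thesis unfolding oomega_def by (rule LeastI_ex)
qed

lemma finite_oless: "b < oomega \<Longrightarrow> finite (oless (b::'k))"
  unfolding oomega_def using not_less_Least by blast

lemma countable_oomega: "countable (oless (oomega::'k))"
  by (rule countable_if_finite_oless) (use finite_oless in \<open>auto simp: oless_def\<close>)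

lemma oless_mono: "a \<le> b \<Longrightarrow> oless a \<subseteq> oless (b::'k)"
  by (auto simp: oless_def)

lemma infinite_oless: "oomega \<le> a \<Longrightarrow> infinite (oless (a::'k))"
  using infinite_oomega oless_mono finite_subset by blast

lemma ozero_less_oomega [simp]: "ozero < (oomega::'k)"
proof (rule ccontr)
  assume "\<not> ozero < (oomega::'k)"
  then have "oless (oomega::'k) = {}"
    unfolding oless_def by (metis (no_types, lifting) Collect_empty_eq not_less not_less_ozero order_le_less_trans)
  then show False using infinite_oomega by simp
qed

lemma osucc_less_oomega: "b < oomega \<Longrightarrow> osucc (b::'k) < oomega"
proof (rule ccontr)
  assume b: "b < oomega" "\<not> osucc b < oomega"
  then have "oless oomega \<subseteq> insert b (oless b)"
    unfolding oless_def by (auto simp: not_less) (metis le_less less_le_trans less_osucc_iff)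
  then show False using infinite_oomega finite_oless[OF b(1)] by (meson finite_insert finite_subset)
qed

lemma oomega_le_limit: "is_limit a \<Longrightarrow> oomega \<le> (a::'k)"
proof (rule ccontr)
  assume a: "is_limit a" "\<not> oomega \<le> a"
  then have fin: "finite (oless a)" using finite_oless by auto
  have ne: "oless a \<noteq> {}" using a(1) by (auto simp: is_limit_def oless_def)
  have "Max (oless a) < a" using Max_in[OF fin ne] by (simp add: oless_def)
  then have "osucc (Max (oless a)) \<in> oless a" using a(1) by (simp add: is_limit_def oless_def)
  then have "osucc (Max (oless a)) \<le> Max (oless a)" using fin by (intro Max_ge)
  then show False by (simp del: Max_ge)
qed

lemma small_lepoll_oless: "X \<prec> (UNIV :: 'k set) \<Longrightarrow> \<exists>a::'k. X \<lesssim> oless a"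
proof -
  assume s: "X \<prec> (UNIV :: 'k set)"
  then obtain f where f: "inj_on f X" "f ` X \<subseteq> (UNIV :: 'k set)"
    unfolding lesspoll_def lepoll_def by blast
  from small_image_bounded[OF s, of f] obtain a where "\<forall>x\<in>X. f x < a" ..
  then have "f ` X \<subseteq> oless a" by (auto simp: oless_def)
  then show ?thesis using f(1) unfolding lepoll_def by blast
qed

lemma UN_lepoll:
  fixes m :: 'k
  assumes "oomega \<le> m" "I \<subseteq> oless m" "\<And>i. i \<in> I \<Longrightarrow> F i \<lesssim> oless m"
  shows "(\<Union>i\<in>I. F i) \<lesssim> oless m"
proof -
  have "\<exists>g. F i \<subseteq> g ` oless m" if "i \<in> I" for i using assms(3)[OF that] by (simp add: lepoll_iff)
  then obtain g where g: "\<And>i. i \<in> I \<Longrightarrow> F i \<subseteq> g i ` oless m" by metis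
  have "(\<Union>i\<in>I. F i) \<subseteq> (\<lambda>(i,x). g i x) ` (oless m \<times> oless m)"
  proof
    fix x assume "x \<in> (\<Union>i\<in>I. F i)"
    then obtain i where i: "i \<in> I" "x \<in> F i" by blast
    then obtain y where "y \<in> oless m" "x = g i y" using g by blast
    then show "x \<in> (\<lambda>(i,x). g i x) ` (oless m \<times> oless m)"
      using i(1) assms(2) by (intro image_eqI[where x = "(i, y)"]) auto
  qed
  then have "(\<Union>i\<in>I. F i) \<lesssim> oless m \<times> oless m" by (rule subset_image_lepoll)
  also have "\<dots> \<lesssim> oless m" using times_self_lepoll infinite_oless[OF assms(1)] by blast
  finally show ?thesis .
qed

text \<open>Each \<open>F i\<close> fits into some \<open>oless (b i)\<close>, and regularity bounds
  \<open>b\<close> on the small index set. The union then fits into the square of one infinite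
  initial segment.\<close>

lemma small_UN:
  fixes I :: "'k set"
  assumes I: "I \<prec> (UNIV :: 'k set)" and F: "\<And>i. i \<in> I \<Longrightarrow> F i \<prec> (UNIV :: 'k set)"
  shows "(\<Union>i\<in>I. F i) \<prec> (UNIV :: 'k set)"
proof -
  from small_imp_bounded[OF I] obtain a where a: "\<forall>i\<in>I. i < a" ..
  have "\<exists>b::'k. F i \<lesssim> oless b" if "i \<in> I" for i using small_lepoll_oless[OF F[OF that]] .
  then obtain b :: "'k \<Rightarrow> 'k" where b: "\<And>i. i \<in> I \<Longrightarrow> F i \<lesssim> oless (b i)" by metis
  from small_image_bounded[OF I, of b] obtain d where d: "\<forall>i\<in>I. b i < d" ..
  define m where "m = max oomega (max a d)"
  have "(\<Union>i\<in>I. F i) \<lesssim> oless m"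
  proof (rule UN_lepoll)
    show "oomega \<le> m" by (simp add: m_def)
    show "I \<subseteq> oless m" using a by (simp add: oless_def m_def less_max_iff_disj subset_iff)
    show "F i \<lesssim> oless m" if "i \<in> I" for i
    proof -
      have "b i \<le> d" using d that by (simp add: less_imp_le)
      then have "oless (b i) \<lesssim> oless m"
        by (intro subset_imp_lepoll oless_mono) (simp add: m_def le_max_iff_disj)
      with b[OF that] show ?thesis by (rule lepoll_trans)
    qed
  qed
  then show ?thesis using oless_small by (rule lesspoll_trans1)
qed

lemma small_Un: "X \<prec> (UNIV :: 'k set) \<Longrightarrow> Y \<prec> (UNIV :: 'k set) \<Longrightarrow> X \<union> Y \<prec> (UNIV :: 'k set)"
proof -
  assume "X \<prec> (UNIV :: 'k set)" "Y \<prec> (UNIV :: 'k set)"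
  then have "(\<Union>i\<in>{ozero, osucc ozero::'k}. if i = ozero then X else Y) \<prec> (UNIV :: 'k set)"
    by (intro small_UN) (auto intro: countable_imp_small)
  moreover have "(\<Union>i\<in>{ozero, osucc ozero::'k}. if i = ozero then X else Y) = X \<union> Y"
    using less_imp_neq[OF ozero_less_osucc, of ozero] by auto
  ultimately show ?thesis by simp
qed

lemma countable_bounded:
  fixes f :: "nat \<Rightarrow> 'k"
  shows "\<exists>a. \<forall>n. f n < a"
  using small_imp_bounded[of "range f"] countable_imp_small[of "range f"] by auto

section \<open>Clubs of closure points\<close>

definition closed_under :: "('k \<Rightarrow> 'k) \<Rightarrow> 'k set" where
  "closed_under G = {b. ozero < b \<and> (\<forall>a<b. G a < b)}"

text \<open>Unboundedness comes from iterating a bound of \<open>G\<close> through the natural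
  numbers; the supremum exists because countable sets are bounded in kappa.\<close>

lemma club_closed_under: "club (closed_under (G :: 'k \<Rightarrow> 'k))"
  unfolding club_def
proof (intro conjI allI impI)
  fix a :: 'k
  have "\<exists>u. \<forall>a\<le>x. G a < u" for x
    using small_image_bounded[OF oless_small[of "osucc x"], of G] by (auto simp: oless_def)
  then obtain H where H: "\<And>x a. a \<le> x \<Longrightarrow> G a < H x" by metis
  define s where "s = rec_nat (osucc a) (\<lambda>_ x. max (H x) (osucc x))"
  have s0: "s 0 = osucc a" and sS: "\<And>n. s (Suc n) = max (H (s n)) (osucc (s n))"
    by (simp_all add: s_def)
  \<comment> \<open>As the least strict upper bound, \<open>u\<close> has some \<open>s n\<close> at
    or above each \<open>x < u\<close>, and \<open>s (Suc n)\<close> is already beyond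
    \<open>G x\<close>.\<close>
  define u where "u = (LEAST u. \<forall>n. s n < u)"
  have u: "\<And>n. s n < u" unfolding u_def using LeastI_ex[OF countable_bounded[of s]] by blast
  have "G x < u" if "x < u" for x
  proof -
    have "\<not> (\<forall>n. s n < x)" using that not_less_Least unfolding u_def by fast
    then obtain n where "x \<le> s n" unfolding not_all not_less ..
    then have "G x < H (s n)" by (rule H)
    also have "H (s n) \<le> s (Suc n)" by (simp add: sS)
    also have "\<dots> < u" by (rule u)
    finally show ?thesis .
  qed
  moreover have "a < u" using u[of 0] s0 by (metis less_osucc less_trans)
  moreover from this have "ozero < u" using ozero_le le_less_trans by blast
  ultimately show "\<exists>d\<in>closed_under G. a \<le> d"
    unfolding closed_under_def by (intro bexI[of _ u]) auto
next
  fix a :: 'k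
  assume a: "ozero < a \<and> is_sup (closed_under G \<inter> oless a) a"
  have "G x < a" if "x < a" for x
  proof -
    obtain y where "y \<in> closed_under G" "y < a" "x < y"
      using a \<open>x < a\<close> unfolding is_sup_def oless_def by auto
    then have "G x < y" unfolding closed_under_def by simp
    then show ?thesis using \<open>y < a\<close> by (rule less_trans)
  qed
  then show "a \<in> closed_under G" using a by (simp add: closed_under_def)
qed

end

section \<open>Sequences\<close>

definition sq_le :: "'k::wellorder kseq \<Rightarrow> 'k kseq \<Rightarrow> bool" where
  "sq_le x y \<longleftrightarrow> fst x \<le> fst y \<and> (\<forall>b<fst x. snd x b = snd y b)"

definition restr :: "'k::wellorder kseq \<Rightarrow> 'k \<Rightarrow> 'k kseq" where
  "restr x b = (b, restrict (snd x) (oless b))"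

definition root :: "'k::wellorder kseq" where
  "root = (ozero, \<lambda>_. undefined)"

lemma sq_le_refl [simp]: "sq_le x x"
  by (simp add: sq_le_def)

lemma sq_le_trans: "sq_le x y \<Longrightarrow> sq_le y z \<Longrightarrow> sq_le x z"
  by (auto simp: sq_le_def)

lemma sq_less_iff: "sq_less x y \<longleftrightarrow> sq_le x y \<and> fst x < fst y"
  by (auto simp: sq_le_def sq_less_def)

lemma sq_le_fst: "sq_le x y \<Longrightarrow> fst x \<le> fst y"
  by (simp add: sq_le_def)

lemma sq_le_below: "sq_le x z \<Longrightarrow> sq_le y z \<Longrightarrow> fst x \<le> fst y \<Longrightarrow> sq_le x y"
  by (auto simp: sq_le_def)

lemma is_seq_eqI:
  assumes "is_seq x" "is_seq y" "fst x = fst y" "\<And>b. b < fst x \<Longrightarrow> snd x b = snd y b"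
  shows "x = y"
proof (rule prod_eqI)
  show "snd x = snd y"
    by (rule PiE_ext[OF assms(1)[unfolded is_seq_def]])
      (use assms in \<open>auto simp: is_seq_def oless_def\<close>)
qed (rule assms(3))

lemma sq_le_antisym:
  assumes "is_seq x" "is_seq y" "sq_le x y" "fst y \<le> fst x"
  shows "x = y"
  using assms by (intro is_seq_eqI) (auto simp: sq_le_def)

lemma compat_iff:
  assumes "is_seq x" "is_seq y"
  shows "compat x y \<longleftrightarrow> sq_le x y \<or> sq_le y x"
proof -
  have "x = y" if "sq_le x y" "\<not> fst x < fst y"
    using sq_le_antisym[OF assms] that by (simp add: not_less)
  moreover have "x = y" if "sq_le y x" "\<not> fst y < fst x"
    using sq_le_antisym[OF assms(2,1)] that by (simp add: not_less)
  ultimately show ?thesis unfolding compat_def sq_less_iff by auto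
qed

lemma fst_restr [simp]: "fst (restr x b) = b"
  by (simp add: restr_def)

lemma is_seq_restr [simp]: "is_seq (restr x b)"
  by (auto simp: restr_def is_seq_def)

lemma sq_le_restr: "b \<le> fst x \<Longrightarrow> sq_le (restr x b) x"
  by (simp add: sq_le_def restr_def oless_def)

lemma restr_eqI: "is_seq y \<Longrightarrow> sq_le y x \<Longrightarrow> fst y = b \<Longrightarrow> restr x b = y"
  by (rule is_seq_eqI) (simp_all, auto simp: sq_le_def restr_def oless_def)

text \<open>This encodes the union of a chain of nodes. The \<open>THE\<close> is meaningful once
  \<open>F\<close> increases along \<open>D\<close>; the height is \<open>b\<close> in every
  case.\<close>

definition glue :: "'k::wellorder set \<Rightarrow> 'k \<Rightarrow> ('k \<Rightarrow> 'k kseq) \<Rightarrow> 'k kseq" where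
  "glue D b F = (b, \<lambda>x\<in>oless b. THE v. \<exists>g\<in>D. g < b \<and> x < fst (F g) \<and> snd (F g) x = v)"

lemma fst_glue [simp]: "fst (glue D b F) = b"
  by (simp add: glue_def)

lemma is_seq_glue [simp]: "is_seq (glue D b F)"
  by (auto simp: glue_def is_seq_def)

lemma glue_cong:
  assumes "D \<inter> oless b = D' \<inter> oless b" "\<And>g. g < b \<Longrightarrow> F g = F' g"
  shows "glue D b F = glue D' b F'"
proof -
  have "(\<exists>g\<in>D. g < b \<and> x < fst (F g) \<and> snd (F g) x = v) \<longleftrightarrow>
      (\<exists>g\<in>D'. g < b \<and> x < fst (F' g) \<and> snd (F' g) x = v)" for x v
    using assms unfolding oless_def by (metis (mono_tags, lifting) IntD1 IntI mem_Collect_eq)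
  then show ?thesis unfolding glue_def by simp
qed

lemma sq_le_glue:
  assumes mono: "\<And>g g'. g \<in> D \<Longrightarrow> g' \<in> D \<Longrightarrow> g \<le> g' \<Longrightarrow> g' < b \<Longrightarrow> sq_le (F g) (F g')"
    and g: "g \<in> D" "g < b" "fst (F g) \<le> b"
  shows "sq_le (F g) (glue D b F)"
  unfolding sq_le_def
proof (intro conjI allI impI)
  fix x assume x: "x < fst (F g)"
  have "(THE v. \<exists>g\<in>D. g < b \<and> x < fst (F g) \<and> snd (F g) x = v) = snd (F g) x"
  proof (rule the_equality)
    show "\<exists>g'\<in>D. g' < b \<and> x < fst (F g') \<and> snd (F g') x = snd (F g) x"
      using g x by blast
  next
    fix v assume "\<exists>g\<in>D. g < b \<and> x < fst (F g) \<and> snd (F g) x = v"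
    then obtain g' where g': "g' \<in> D" "g' < b" "x < fst (F g')" "snd (F g') x = v" by blast
    consider "g \<le> g'" | "g' \<le> g" by force
    then show "v = snd (F g) x"
    proof cases
      case 1
      from mono[OF g(1) g'(1) 1 g'(2)] show ?thesis using x g' unfolding sq_le_def by auto
    next
      case 2
      from mono[OF g'(1) g(1) 2 g(2)] show ?thesis using x g' unfolding sq_le_def by auto
    qed
  qed
  moreover have "x < b" using x g(3) by simp
  ultimately show "snd (F g) x = snd (glue D b F) x"
    by (simp add: glue_def oless_def)
qed (use g in simp)

lemma fst_concat1 [simp]: "fst (concat1 x i) = osucc (fst x)"
  by (simp add: concat1_def)

section \<open>The construction\<close>

text \<open>The parameters are witnesses for the hypotheses: \<open>A\<close> is the diamond
  sequence, \<open>C\<close> the coherent club sequence, \<open>pr\<close> an injective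
  pairing.\<close>

locale tree_construction = regular_kappa ty for ty :: "'k::wellorder itself" +
  fixes c :: 'k and C A :: "'k \<Rightarrow> 'k set" and pr :: "'k \<times> 'k \<Rightarrow> 'k"
  assumes card: "is_cardinal c"
    and pow: "seqs_below (l::'k) c \<prec> (UNIV :: 'k set)"
    and inj_pr: "inj pr"
    and diamond_guess: "stationary {a. X \<inter> oless a = A a}"
    and C_club: "is_limit a \<Longrightarrow> club_in (C a) a"
    and C_coherent: "a' \<in> acc (C a) \<Longrightarrow> C a' = C a \<inter> oless a'"
    and C_hits: "(\<And>i b. \<exists>x\<in>H i. b \<le> x) \<Longrightarrow>
      stationary {a\<in>E_ge c. \<forall>i<a. is_sup {b\<in>C a. succ_omega {d\<in>C a. b \<le> d} \<subseteq> H i} a}"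
begin

definition good :: "'k \<Rightarrow> bool" where
  "good t \<longleftrightarrow> ozero < t \<and> (t < c \<or> t = osucc ozero)"

definition tuples :: "'k kseq set \<Rightarrow> ('k \<times> ('k \<Rightarrow> 'k kseq)) set" where
  "tuples L = {(t, x). good t \<and> x \<in> oless t \<rightarrow>\<^sub>E L}"

definition enum :: "'k kseq set \<Rightarrow> 'k \<Rightarrow> 'k \<times> ('k \<Rightarrow> 'k kseq)" where
  "enum L = (SOME g. tuples L \<subseteq> range g)"

definition code_ht :: "'k \<Rightarrow> 'k" where
  "code_ht d = fst (inv pr d)"

text \<open>A code is a pair of a level and a position in the chosen enumeration of the tuples of nodes on
  that level, so that it can be read off from any initial part of the tree containing the level.\<close>

definition tup :: "'k kseq set \<Rightarrow> 'k \<Rightarrow> 'k \<times> ('k \<Rightarrow> 'k kseq)" where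
  "tup T d = enum (level T (code_ht d)) (snd (inv pr d))"

text \<open>The guess \<^term>\<open>A b\<close> is read as \<open>{pr (i, d) | d \<in> X}\<close>, where \<open>i\<close> codes a tuple of nodes
  and \<open>X\<close> is a set of codes, meant to be a dense open set of a derived tree.\<close>

definition guess_ix :: "'k \<Rightarrow> 'k" where
  "guess_ix b = fst (inv pr (LEAST e. e \<in> A b))"

definition guess_set :: "'k \<Rightarrow> 'k set" where
  "guess_set b = {d. pr (guess_ix b, d) \<in> A b \<and> code_ht d < b}"

text \<open>The map \<open>g\<close> sends a starting node to the node its branch has reached before
  level \<open>b\<close>. One \<open>z\<close> serves all coordinates, because the aim is to meet a
  set of tuples and not of single nodes.\<close>

definition seals :: "'k kseq set \<Rightarrow> 'k \<Rightarrow> ('k kseq \<Rightarrow> 'k kseq) \<Rightarrow> ('k \<Rightarrow> 'k kseq) \<Rightarrow> bool" where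
  "seals T b g z \<longleftrightarrow>
    (let t = fst (tup T (guess_ix b)); x = snd (tup T (guess_ix b)) in
      (\<forall>j<t. z j \<in> level T b \<and> sq_less (g (x j)) (z j)) \<and>
      (\<exists>d\<in>guess_set b. fst (tup T d) = t \<and> (\<forall>j<t. sq_le (snd (tup T d) j) (z j))))"

text \<open>The choice of the sealing \<open>z\<close> depends on \<open>T\<close>, \<open>b\<close>
  and \<open>g\<close> but not on \<open>y\<close>. Hence branches that are computed separately pick
  coordinates of the same \<open>z\<close>. Nodes outside the guessed tuple receive an arbitrary
  extension.\<close>

definition step :: "'k kseq set \<Rightarrow> 'k \<Rightarrow> ('k kseq \<Rightarrow> 'k kseq) \<Rightarrow> 'k kseq \<Rightarrow> 'k kseq" where
  "step T b g y =
    (let t = fst (tup T (guess_ix b)); x = snd (tup T (guess_ix b)) in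
      if (\<exists>z. seals T b g z) \<and> (\<exists>j<t. g (x j) = y)
      then (SOME z. seals T b g z) (SOME j. j < t \<and> g (x j) = y)
      else SOME z. z \<in> level T b \<and> sq_less y z)"

text \<open>Level \<open>b\<close> is retained, because \<open>step\<close> at \<open>b\<close>
  selects nodes of height \<open>b\<close>.\<close>

definition trunc :: "'k kseq set \<Rightarrow> 'k \<Rightarrow> 'k kseq set" where
  "trunc T b = {x\<in>T. fst x \<le> b}"

definition pred :: "'k set \<Rightarrow> 'k \<Rightarrow> 'k" where
  "pred D b = (GREATEST g. g \<in> D \<inter> oless b)"

text \<open>\<open>branch T D b x\<close> is the node of height \<open>b\<close> reached by climbing from \<open>x\<close> through the levels of
  \<open>T\<close> with indices in \<open>D\<close>; for \<open>b \<le> fst x\<close> it is \<open>x\<close>.\<close>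

definition branch_step ::
    "'k kseq set \<Rightarrow> 'k set \<Rightarrow> ('k \<Rightarrow> 'k kseq \<Rightarrow> 'k kseq) \<Rightarrow> 'k \<Rightarrow> 'k kseq \<Rightarrow> 'k kseq" where
  "branch_step T D F b x =
    (if b \<le> fst x then x
     else if is_sup (D \<inter> oless b) b then glue D b (\<lambda>g. F g x)
     else step (trunc T b) b (F (pred D b)) (F (pred D b) x))"

definition branch :: "'k kseq set \<Rightarrow> 'k set \<Rightarrow> 'k \<Rightarrow> 'k kseq \<Rightarrow> 'k kseq" where
  "branch T D = wfrec {(a, b). a < b} (branch_step T D)"

definition next_level :: "'k kseq set \<Rightarrow> 'k \<Rightarrow> 'k kseq set" where
  "next_level T a =
    (if a = ozero then {root}
     else if is_limit a then {branch T (C a) a x | x. x \<in> T \<and> fst x \<in> C a}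
     else {concat1 x i | x i. x \<in> T \<and> osucc (fst x) = a \<and> i < max oomega (fst x)})"

definition Lev :: "'k \<Rightarrow> 'k kseq set" where
  "Lev = wfrec {(a, b). a < b} (\<lambda>F a. next_level (\<Union>b\<in>oless a. F b) a)"

definition Tree :: "'k kseq set" where
  "Tree = (\<Union>a. Lev a)"

section \<open>Unfolding the recursions\<close>

lemma branch_unfold: "branch T D b = branch_step T D (cut (branch T D) {(a, b). a < b} b) b"
  unfolding branch_def by (rule wfrec) (rule wf)

lemma branch_below: "b \<le> fst x \<Longrightarrow> branch T D b x = x"
  by (subst branch_unfold) (simp add: branch_step_def)

lemma branch_glue:
  assumes "fst x < b" "is_sup (D \<inter> oless b) b"
  shows "branch T D b x = glue D b (\<lambda>g. branch T D g x)"
proof -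
  have "branch T D b x = glue D b (\<lambda>g. cut (branch T D) {(a, b). a < b} b g x)"
    by (subst branch_unfold) (use assms in \<open>simp add: branch_step_def not_le[symmetric]\<close>)
  also have "\<dots> = glue D b (\<lambda>g. branch T D g x)"
    by (rule glue_cong) (simp_all add: cut_def)
  finally show ?thesis .
qed

lemma branch_step:
  assumes "fst x < b" "\<not> is_sup (D \<inter> oless b) b" "pred D b < b"
  shows "branch T D b x =
    step (trunc T b) b (branch T D (pred D b)) (branch T D (pred D b) x)"
  by (subst branch_unfold) (use assms in \<open>simp add: branch_step_def cut_def not_le[symmetric]\<close>)

text \<open>At an accumulation point of \<open>D\<close> lower nodes are glued, so level
  \<open>b\<close> is read only at the other points. This allows the initial part available during
  the recursion to be replaced by \<open>Tree\<close> and, by coherence, \<open>C a\<close> by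
  \<open>C b\<close> for \<open>b\<close> in \<open>acc (C a)\<close>.\<close>

lemma branch_cong:
  assumes "\<And>x. fst x < b \<Longrightarrow> x \<in> T \<longleftrightarrow> x \<in> T'"
    and "\<And>x. fst x = b \<Longrightarrow> \<not> is_sup (D \<inter> oless b) b \<Longrightarrow> x \<in> T \<longleftrightarrow> x \<in> T'"
    and "D \<inter> oless b = D' \<inter> oless b"
  shows "branch T D b = branch T' D' b"
  using assms
proof (induction b rule: less_induct)
  case (less b)
  have IH: "branch T D a = branch T' D' a" if "a < b" for a
  proof (rule less.IH[OF that])
    have "D \<inter> oless a = (D \<inter> oless b) \<inter> oless a" "D' \<inter> oless a = (D' \<inter> oless b) \<inter> oless a"
      using oless_mono[OF less_imp_le[OF that]] by blast+
    then show "D \<inter> oless a = D' \<inter> oless a" by (simp only: less.prems(3))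
  next
    show "x \<in> T \<longleftrightarrow> x \<in> T'" if "fst x < a" for x
      using less.prems(1) less_trans[OF that \<open>a < b\<close>] .
    show "x \<in> T \<longleftrightarrow> x \<in> T'" if "fst x = a" for x
      using less.prems(1) \<open>a < b\<close> that by simp
  qed
  have cut: "cut (branch T D) {(a, b). a < b} b = cut (branch T' D') {(a, b). a < b} b"
    by (rule ext) (simp add: cut_def IH)
  have pred: "pred D b = pred D' b" unfolding pred_def less.prems(3) ..
  have trunc: "trunc T b = trunc T' b" if "\<not> is_sup (D \<inter> oless b) b"
    using less.prems(1,2) that unfolding trunc_def le_less by auto
  have "branch_step T D F b x = branch_step T' D' F b x" for F x
    using trunc glue_cong[OF less.prems(3), of "\<lambda>g. F g x" "\<lambda>g. F g x"]
    unfolding branch_step_def pred less.prems(3) by simp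
  then show ?case
    by (subst (1 2) branch_unfold) (simp only: cut fun_eq_iff simp_thms)
qed

lemma Lev_unfold: "Lev a = next_level (\<Union>b\<in>oless a. Lev b) a"
proof -
  have "Lev a = next_level (\<Union>b\<in>oless a. cut Lev {(a, b). a < b} a b) a"
    unfolding Lev_def by (subst wfrec) (auto intro: wf)
  also have "(\<Union>b\<in>oless a. cut Lev {(a, b). a < b} a b) = (\<Union>b\<in>oless a. Lev b)"
    by (auto simp: cut_def oless_def)
  finally show ?thesis .
qed

lemma club_in_is_sup:
  assumes "is_limit (a::'k)" "club_in D a"
  shows "is_sup (D \<inter> oless a) a"
  unfolding is_sup_def
proof (intro conjI allI impI ballI)
  fix b assume "b < a"
  then have "osucc b < a" using assms(1) by (simp add: is_limit_def)
  then obtain d where "d \<in> D" "osucc b \<le> d" using assms(2) unfolding club_in_def by blast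
  then show "\<exists>x\<in>D \<inter> oless a. b < x" using assms(2) unfolding club_in_def
    by (intro bexI[of _ d]) auto
qed (auto simp: oless_def)

lemma C_subset: "is_limit a \<Longrightarrow> b \<in> C a \<Longrightarrow> b < a"
  using C_club unfolding club_in_def oless_def by blast

lemma C_unbounded: "is_limit a \<Longrightarrow> b < a \<Longrightarrow> \<exists>d\<in>C a. b < d"
  using club_in_is_sup[OF _ C_club] unfolding is_sup_def by blast

lemma Lev_fst: "x \<in> Lev a \<Longrightarrow> fst x = a"
proof -
  assume "x \<in> Lev a"
  then have x: "x \<in> next_level (\<Union>b\<in>oless a. Lev b) a" using Lev_unfold by blast
  show "fst x = a"
  proof (cases "is_limit a")
    case True
    then have "a \<noteq> ozero" by (auto simp: is_limit_def)
    then obtain y T where "fst y \<in> C a" "x = branch T (C a) a y"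
      using x True by (auto simp: next_level_def)
    then show ?thesis using branch_glue[OF C_subset club_in_is_sup[OF _ C_club]] True by simp
  next
    case False
    then show ?thesis using x by (auto simp: next_level_def root_def concat1_def split: if_splits)
  qed
qed

lemma Tree_iff: "x \<in> Tree \<longleftrightarrow> x \<in> Lev (fst x)"
  using Lev_fst[of x] unfolding Tree_def by blast

lemma level_Tree [simp]: "level Tree a = Lev a"
  using Lev_fst by (auto simp: level_def Tree_iff)

lemma level_trunc: "b \<le> a \<Longrightarrow> level (trunc Tree a) b = Lev b"
  using level_Tree[of b] by (auto simp: level_def trunc_def)

lemma tup_trunc: "code_ht d \<le> b \<Longrightarrow> tup (trunc Tree b) d = tup Tree d"
  by (simp add: tup_def level_trunc)

lemma UN_Lev: "(\<Union>b\<in>oless a. Lev b) = {x\<in>Tree. fst x < a}"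
  using Lev_fst by (auto simp: Tree_iff oless_def)

lemma Lev_ozero: "Lev ozero = {root}"
  by (subst Lev_unfold) (simp add: next_level_def)

lemma Lev_osucc: "Lev (osucc a) = {concat1 x i | x i. x \<in> Lev a \<and> i < max oomega a}"
proof -
  have "osucc a \<noteq> ozero" using less_imp_neq[OF ozero_less_osucc] by metis
  then have "Lev (osucc a) = {concat1 x i | x i.
      x \<in> {x\<in>Tree. fst x < osucc a} \<and> fst x = a \<and> i < max oomega (fst x)}"
    by (subst Lev_unfold) (simp add: next_level_def UN_Lev)
  moreover have "x \<in> {x\<in>Tree. fst x < osucc a} \<and> fst x = a \<and> i < max oomega (fst x) \<longleftrightarrow>
      x \<in> Lev a \<and> i < max oomega a" for x i
    by (cases "fst x = a") (use Lev_fst[of x a] in \<open>simp_all add: Tree_iff, blast?\<close>)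
  ultimately show ?thesis by (simp only:)
qed

abbreviation climb :: "'k set \<Rightarrow> 'k \<Rightarrow> 'k kseq \<Rightarrow> 'k kseq" where
  "climb \<equiv> branch Tree"

text \<open>The branch to \<open>a\<close> is glued at \<open>a\<close>, as \<open>C a\<close> is
  cofinal in \<open>a\<close>; it thus reads only levels below \<open>a\<close>, where the partial
  tree of the recursion agrees with \<open>Tree\<close>.\<close>

lemma Lev_limit:
  assumes "is_limit a"
  shows "Lev a = {climb (C a) a x | x. x \<in> Tree \<and> fst x \<in> C a}"
proof -
  have "branch {x\<in>Tree. fst x < a} (C a) a = climb (C a) a"
    using club_in_is_sup[OF assms C_club[OF assms]] by (intro branch_cong) auto
  moreover have "a \<noteq> ozero" using assms by (auto simp: is_limit_def)
  ultimately show ?thesis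
    using C_subset[OF assms] by (subst Lev_unfold) (auto simp: next_level_def UN_Lev assms)
qed

lemma is_seq_concat1: "is_seq x \<Longrightarrow> is_seq (concat1 x (i::'k))"
  unfolding is_seq_def concat1_def PiE_def extensional_def oless_def by auto

lemma sq_le_concat1: "sq_le x (concat1 x (i::'k))"
  by (simp add: sq_le_def concat1_def less_imp_le)

text \<open>A point of \<open>D\<close> below \<open>b\<close> is needed: otherwise \<^term>\<open>pred D b\<close> is unspecified.\<close>

lemma pred_greatest:
  assumes D: "club_in D a" and a: "is_limit a" and b: "b \<le> (a::'k)" "\<not> is_sup (D \<inter> oless b) b"
    and x: "x \<in> D" "x < b"
  shows "pred D b \<in> D" "pred D b < b" "\<And>d. d \<in> D \<Longrightarrow> d < b \<Longrightarrow> d \<le> pred D b"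
proof -
  obtain u where u: "u < b" "\<forall>d\<in>D \<inter> oless b. d \<le> u"
    using b(2) unfolding is_sup_def by (auto simp: oless_def not_less)
  define g where "g = (LEAST u. \<forall>d\<in>D \<inter> oless b. d \<le> u)"
  have g: "\<forall>d\<in>D \<inter> oless b. d \<le> g" unfolding g_def by (rule LeastI[where P = "\<lambda>u. \<forall>d\<in>D \<inter> oless b. d \<le> u", OF u(2)])
  have "g \<le> u" unfolding g_def by (rule Least_le[where P = "\<lambda>u. \<forall>d\<in>D \<inter> oless b. d \<le> u", OF u(2)])
  then have gb: "g < b" using u(1) by simp
  have gD: "g \<in> D"
  proof (rule ccontr)
    \<comment> \<open>The least upper bound \<open>g\<close> would then be a limit of points of
      \<open>D\<close>, and closedness puts it into \<open>D\<close>.\<close>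
    assume "g \<notin> D"
    then have less: "d < g" if "d \<in> D" "d < b" for d
      using g that by (metis IntI mem_Collect_eq oless_def order.not_eq_order_implies_strict)
    have "is_sup (D \<inter> oless g) g"
      unfolding is_sup_def
    proof (intro conjI allI impI)
      fix v assume "v < g"
      then have "\<not> (\<forall>d\<in>D \<inter> oless b. d \<le> v)" unfolding g_def by (rule not_less_Least)
      then obtain d where "d \<in> D" "d < b" "v < d" by (auto simp: oless_def not_le)
      then show "\<exists>d\<in>D \<inter> oless g. v < d" using less by (auto simp: oless_def)
    qed (auto simp: oless_def)
    moreover have "ozero < g" using less[OF x] le_less_trans[OF ozero_le] by blast
    moreover have "g < a" using gb b(1) by simp
    ultimately show False using D \<open>g \<notin> D\<close> unfolding club_in_def by blast
  qed
  have "pred D b = g"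
    unfolding pred_def by (rule Greatest_equality) (use g gD gb in \<open>auto simp: oless_def\<close>)
  then show "pred D b \<in> D" "pred D b < b" "\<And>d. d \<in> D \<Longrightarrow> d < b \<Longrightarrow> d \<le> pred D b"
    using g gD gb by (auto simp: oless_def)
qed

lemma seals_mem:
  assumes "seals T b g z" "j < fst (tup T (guess_ix b))"
  shows "z j \<in> level T b" "sq_less (g (snd (tup T (guess_ix b)) j)) (z j)"
  using assms by (auto simp: seals_def Let_def)

text \<open>A seal already contains an extension of \<open>y\<close>; only the default case draws on
  the assumption.\<close>

lemma step_mem:
  assumes "\<exists>z\<in>level T b. sq_less y z"
  shows "step T b g y \<in> level T b \<and> sq_less y (step T b g y)"
proof (cases "(\<exists>z. seals T b g z) \<and> (\<exists>j<fst (tup T (guess_ix b)). g (snd (tup T (guess_ix b)) j) = y)")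
  case True
  define z where "z = (SOME z. seals T b g z)"
  define j where "j = (SOME j. j < fst (tup T (guess_ix b)) \<and> g (snd (tup T (guess_ix b)) j) = y)"
  have z: "seals T b g z" unfolding z_def using True by (intro someI_ex[of "seals T b g"]) simp
  have j: "j < fst (tup T (guess_ix b)) \<and> g (snd (tup T (guess_ix b)) j) = y"
    unfolding j_def by (rule someI_ex) (use True in blast)
  have "step T b g y = z j" using True by (simp add: step_def z_def j_def)
  then show ?thesis using seals_mem[OF z] j by auto
next
  case False
  then have "step T b g y = (SOME z. z \<in> level T b \<and> sq_less y z)"
    by (auto simp only: step_def Let_def split: if_splits)
  then show ?thesis using someI_ex[of "\<lambda>z. z \<in> level T b \<and> sq_less y z"] assms by auto
qed

section \<open>Levels and canonical branches\<close>

text \<open>This is the joint induction hypothesis: closure under restriction, extendibility to all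
  higher levels, and the size bound. Extendibility below a limit is what keeps branches from getting
  stuck.\<close>

definition sound :: "'k \<Rightarrow> bool" where
  "sound a \<longleftrightarrow> (\<forall>x\<in>Lev a. is_seq x) \<and> (\<forall>x\<in>Lev a. \<forall>b<a. restr x b \<in> Lev b) \<and>
    (\<forall>b<a. \<forall>x\<in>Lev b. \<exists>y\<in>Lev a. sq_less x y) \<and> Lev a \<lesssim> oless (max oomega a)"

text \<open>Induction on \<open>b\<close>: gluing at limits of \<open>C a\<close>,
  \<open>step_mem\<close> at the other points. Membership in \<open>Lev b\<close> is claimed only
  for \<open>b < a\<close>, since level \<open>a\<close> is not yet known to be sound.\<close>

lemma climb_props:
  assumes a: "is_limit a" and sound: "\<And>b. b < a \<Longrightarrow> sound b"
    and x: "x \<in> Tree" "fst x \<in> C a" and b: "b \<in> C a \<or> b = a" "fst x \<le> b"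
  shows "is_seq (climb (C a) b x) \<and> fst (climb (C a) b x) = b \<and>
    (b < a \<longrightarrow> climb (C a) b x \<in> Lev b) \<and>
    (\<forall>g\<in>C a. g \<le> b \<longrightarrow> sq_le (climb (C a) g x) (climb (C a) b x))"
  using b
proof (induction b rule: less_induct)
  case (less b)
  have ba: "b \<le> a" using less.prems(1) C_subset[OF a] by (auto intro: less_imp_le)
  have xa: "fst x < a" using C_subset[OF a x(2)] .
  have below: "sq_le (climb (C a) g x) y" if "sq_le x y" "g \<le> fst x" for g y
    using that by (simp add: branch_below)
  show ?case
  proof (cases "b = fst x")
    case True
    then have "climb (C a) g x = x" if "g \<le> b" for g using that by (simp add: branch_below)
    moreover have "is_seq x" using sound[OF xa] x(1) by (simp add: sound_def Tree_iff)
    ultimately show ?thesis using True x(1) by (auto simp: Tree_iff)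
  next
    case False
    then have xb: "fst x < b" using less.prems(2) by simp
    have IH: "is_seq (climb (C a) g x)" "fst (climb (C a) g x) = g" "climb (C a) g x \<in> Lev g"
      "\<And>h. h \<in> C a \<Longrightarrow> h \<le> g \<Longrightarrow> sq_le (climb (C a) h x) (climb (C a) g x)"
      if "g \<in> C a" "g < b" "fst x \<le> g" for g
      using less.IH[of g] that C_subset[OF a] by auto
    show ?thesis
    proof (cases "is_sup (C a \<inter> oless b) b")
      case True
      note glue = branch_glue[OF xb True, of Tree]
      have mono: "sq_le (climb (C a) g x) (climb (C a) h x)"
        if "g \<in> C a" "h \<in> C a" "g \<le> h" "h < b" for g h
      proof (cases "fst x \<le> h")
        case True then show ?thesis using IH(4) that by blast
      next
        case False then show ?thesis using that by (simp add: branch_below)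
      qed
      have le: "sq_le (climb (C a) g x) (climb (C a) b x)" if g: "g \<in> C a" "g \<le> b" for g
      proof (cases "g = b")
        case False
        then have "g < b" using g by simp
        moreover from this have "fst (climb (C a) g x) \<le> b"
          by (cases "fst x \<le> g") (use IH(2) g xb in \<open>auto simp: branch_below\<close>)
        ultimately show ?thesis unfolding glue using mono g by (intro sq_le_glue) auto
      qed simp
      moreover have "climb (C a) b x \<in> Lev b" if "b < a"
      proof -
        have bC: "b \<in> C a" using that less.prems(1) by auto
        have pos: "ozero < b" using le_less_trans[OF ozero_le xb] .
        \<comment> \<open>Coherence turns the branch along \<open>C a\<close> into one along
          \<open>C b\<close>, and these are the nodes that level \<open>b\<close> keeps.\<close>
        then have "b \<in> acc (C a)" using bC True by (simp add: acc_def)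
        then have Cb: "C b = C a \<inter> oless b" by (rule C_coherent)
        have lim: "is_limit b" using is_limitI[OF pos True] .
        have eq: "climb (C a) b = climb (C b) b" by (rule branch_cong) (auto simp: Cb)
        have "fst x \<in> C b" using x(2) xb by (simp add: Cb oless_def)
        then show ?thesis using x(1) unfolding Lev_limit[OF lim] eq by blast
      qed
      ultimately show ?thesis by (simp add: glue)
    next
      case False
      \<comment> \<open>The case \<open>b = a\<close> is excluded because \<open>a\<close> is a
        limit of \<open>C a\<close>.\<close>
      have bC: "b \<in> C a" using less.prems(1) False club_in_is_sup[OF a C_club[OF a]] by auto
      then have "b < a" using C_subset[OF a] by simp
      define g where "g = pred (C a) b"
      have g: "g \<in> C a" "g < b" "\<And>d. d \<in> C a \<Longrightarrow> d < b \<Longrightarrow> d \<le> g"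
        using pred_greatest[OF C_club[OF a] a ba False x(2) xb] unfolding g_def by auto
      have xg: "fst x \<le> g" using g(3)[OF x(2) xb] .
      define y where "y = climb (C a) g x"
      have y: "y \<in> Lev g" unfolding y_def by (rule IH(3)[OF g(1,2) xg])
      have "\<exists>z\<in>level (trunc Tree b) b. sq_less y z"
        using sound[OF \<open>b < a\<close>] y g(2) by (auto simp: level_trunc sound_def)
      from step_mem[OF this, of "climb (C a) g"]
      have st: "climb (C a) b x \<in> Lev b" "sq_le y (climb (C a) b x)"
        unfolding branch_step[OF xb False, OF g(2)[unfolded g_def]] g_def[symmetric] y_def[symmetric]
        by (auto simp: level_trunc sq_less_iff)
      have "sq_le (climb (C a) d x) (climb (C a) b x)" if "d \<in> C a" "d \<le> b" for d
      proof (cases "d = b")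
        case False
        then have "d \<le> g" using that g(3) by simp
        then have "sq_le (climb (C a) d x) y" unfolding y_def using IH(4)[OF g(1,2) xg] that by blast
        then show ?thesis using st(2) sq_le_trans by blast
      qed simp
      then show ?thesis using st(1) sound[OF \<open>b < a\<close>] Lev_fst[OF st(1)] by (auto simp: sound_def)
    qed
  qed
qed

lemma sq_le_climb:
  assumes "is_limit a" "\<And>b. b < a \<Longrightarrow> sound b" "x \<in> Tree" "fst x \<in> C a" "b \<in> C a \<or> b = a" "fst x \<le> b"
  shows "sq_le x (climb (C a) b x)"
  using climb_props[OF assms] assms(4,6) branch_below[of "fst x" x Tree "C a"] by force

lemma restr_mem:
  assumes "sound a" "x \<in> Lev a" "b \<le> a"
  shows "restr x b \<in> Lev b"
proof (cases "b = a")
  case True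
  have "is_seq x" using assms by (simp add: sound_def)
  then have "restr x b = x" using True Lev_fst[OF assms(2)] by (intro restr_eqI) auto
  then show ?thesis using assms True by simp
qed (use assms in \<open>auto simp: sound_def\<close>)

lemma sound_ozero: "sound ozero"
proof -
  have "{root :: 'k kseq} \<lesssim> oless (max oomega ozero :: 'k)"
    by (intro finite_lepoll_infinite infinite_oless) simp_all
  then show ?thesis
    unfolding sound_def Lev_ozero by (auto simp: root_def is_seq_def oless_def)
qed

lemma sound_osucc:
  assumes "sound a"
  shows "sound (osucc a)"
proof -
  have seq: "is_seq x" if "x \<in> Lev a" for x using assms that by (simp add: sound_def)
  have "is_seq x" if "x \<in> Lev (osucc a)" for x
    using that seq unfolding Lev_osucc by (auto intro: is_seq_concat1)
  moreover have "restr x b \<in> Lev b" if xL: "x \<in> Lev (osucc a)" and b: "b < osucc a" for x b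
  proof -
    obtain y i where y: "x = concat1 y i" "y \<in> Lev a" using xL unfolding Lev_osucc by blast
    have "restr x b = restr y b"
      using b Lev_fst[OF y(2)] unfolding y(1)
      by (intro restr_eqI is_seq_restr sq_le_trans[OF sq_le_restr sq_le_concat1]) auto
    then show ?thesis using restr_mem[OF assms y(2)] b by simp
  qed
  moreover have "\<exists>y\<in>Lev (osucc a). sq_less x y" if xL: "x \<in> Lev b" and b: "b < osucc a" for x b
  proof -
    have "\<exists>y\<in>Lev a. sq_le x y"
    proof (cases "b = a")
      case False
      then have "b < a" using b by simp
      then show ?thesis using xL assms unfolding sound_def sq_less_iff by blast
    qed (use xL in \<open>auto intro: sq_le_refl bexI[of _ x]\<close>)
    then obtain y where y: "y \<in> Lev a" "sq_le x y" by blast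
    have "concat1 y ozero \<in> Lev (osucc a)"
      unfolding Lev_osucc using y(1) by (intro CollectI exI[of _ y] exI[of _ ozero]) (simp add: less_max_iff_disj)
    moreover have "sq_less x (concat1 y ozero)"
      using sq_le_trans[OF y(2) sq_le_concat1] Lev_fst[OF xL] Lev_fst[OF y(1)] b
      by (simp add: sq_less_iff)
    ultimately show ?thesis by blast
  qed
  moreover have "Lev (osucc a) \<lesssim> oless (max oomega (osucc a))"
  proof -
    define m where "m = max oomega a"
    have "Lev (osucc a) \<subseteq> (\<lambda>(x, i). concat1 x i) ` (Lev a \<times> oless m)"
      unfolding Lev_osucc m_def oless_def by auto
    then have "Lev (osucc a) \<lesssim> Lev a \<times> oless m" by (rule subset_image_lepoll)
    also have "\<dots> \<lesssim> oless m \<times> oless m"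
      using assms by (intro times_lepoll_mono lepoll_refl) (simp add: sound_def m_def)
    also have "\<dots> \<lesssim> oless m" by (intro times_self_lepoll infinite_oless) (simp add: m_def)
    also have "\<dots> \<lesssim> oless (max oomega (osucc a))"
      unfolding m_def by (intro subset_imp_lepoll oless_mono max.mono less_imp_le[OF less_osucc] order_refl)
    finally show ?thesis .
  qed
  ultimately show ?thesis unfolding sound_def by blast
qed

text \<open>Restrictions are read off at a level of \<open>C a\<close> above both \<open>b\<close>
  and the start of the branch. To extend a node, it is first lifted to a level in \<open>C a\<close>
  and then climbed from. A branch is determined by its starting node, which gives the size
  bound.\<close>

lemma sound_limit:
  assumes a: "is_limit a" and IH: "\<And>b. b < a \<Longrightarrow> sound b"
  shows "sound a"
proof -
  note props = climb_props[OF a IH, OF _ _ _ disjI2[OF refl]] and subset = C_subset[OF a]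
  have "is_seq x" if "x \<in> Lev a" for x
    using that props subset unfolding Lev_limit[OF a] by (auto simp: less_imp_le)
  moreover have "restr x b \<in> Lev b" if xL: "x \<in> Lev a" and b: "b < a" for x b
  proof -
    obtain y where y: "x = climb (C a) a y" "y \<in> Tree" "fst y \<in> C a"
      using xL unfolding Lev_limit[OF a] by blast
    obtain g where g: "g \<in> C a" "max b (fst y) < g"
      using C_unbounded[OF a, of "max b (fst y)"] b subset[OF y(3)] by auto
    define z where "z = climb (C a) g y"
    have "fst y \<le> g" using g(2) by (simp add: less_imp_le)
    from climb_props[OF a IH y(2,3) _ this] g(1) have z: "z \<in> Lev g"
      unfolding z_def using subset by blast
    have "sq_le z x" unfolding z_def y(1)
      using props[OF _ y(2,3)] g(1) subset y(3) by (auto simp: less_imp_le)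
    then have "restr x b = restr z b"
      using Lev_fst[OF z] g(2) by (intro restr_eqI is_seq_restr sq_le_trans[OF sq_le_restr]) auto
    then show ?thesis using restr_mem[OF IH z] subset[OF g(1)] g(2) by (simp add: less_imp_le)
  qed
  moreover have "\<exists>y\<in>Lev a. sq_less x y" if xL: "x \<in> Lev b" and b: "b < a" for x b
  proof -
    obtain g where g: "g \<in> C a" "b < g" using C_unbounded[OF a b] by blast
    obtain y where y: "y \<in> Lev g" "sq_less x y"
      using IH[OF subset[OF g(1)]] xL g(2) unfolding sound_def by blast
    have yT: "y \<in> Tree" "fst y \<in> C a" "fst y \<le> a"
      using y(1) Lev_fst[OF y(1)] g(1) subset[OF g(1)] by (auto simp: Tree_iff)
    have "climb (C a) a y \<in> Lev a" unfolding Lev_limit[OF a] using yT by blast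
    moreover have "sq_less x (climb (C a) a y)"
      using sq_le_trans[OF _ sq_le_climb[OF a IH yT(1,2) disjI2[OF refl] yT(3)], of x] y(2) xL b
        props[OF _ yT] Lev_fst[OF xL] by (auto simp: sq_less_iff)
    ultimately show ?thesis by blast
  qed
  moreover have "Lev a \<lesssim> oless (max oomega a)"
  proof -
    have om: "oomega \<le> a" by (rule oomega_le_limit[OF a])
    have "Lev a \<subseteq> climb (C a) a ` (\<Union>b\<in>oless a. Lev b)"
      unfolding Lev_limit[OF a] UN_Lev using subset by auto
    then have "Lev a \<lesssim> (\<Union>b\<in>oless a. Lev b)" by (rule subset_image_lepoll)
    also have "\<dots> \<lesssim> oless a"
    proof (rule UN_lepoll[OF om order_refl])
      fix b assume "b \<in> oless a"
      then have b: "b < a" by (simp add: oless_def)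
      then have "Lev b \<lesssim> oless (max oomega b)" using IH by (simp add: sound_def)
      also have "\<dots> \<lesssim> oless a"
        by (intro subset_imp_lepoll oless_mono) (use b om in auto)
      finally show "Lev b \<lesssim> oless a" .
    qed
    finally show ?thesis using om by (simp add: max_def)
  qed
  ultimately show ?thesis unfolding sound_def by blast
qed

lemma sound: "sound a"
proof (induction a rule: less_induct)
  case (less a)
  show ?case
  proof (cases a rule: limit_cases)
    case 1 then show ?thesis by (simp add: sound_ozero)
  next
    case (2 b) then show ?thesis using less by (simp add: sound_osucc)
  next
    case 3 then show ?thesis using less by (blast intro: sound_limit)
  qed
qed

lemma Lev_is_seq: "x \<in> Lev a \<Longrightarrow> is_seq x"
  using sound[of a] by (simp add: sound_def)

lemma Lev_restr: "x \<in> Lev a \<Longrightarrow> b \<le> a \<Longrightarrow> restr x b \<in> Lev b"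
  by (rule restr_mem[OF sound])

lemma Lev_extend:
  assumes "x \<in> Lev b" "b \<le> a"
  shows "\<exists>y\<in>Lev a. sq_le x y"
proof (cases "b = a")
  case False
  then have "b < a" using assms by simp
  then show ?thesis using assms sound[of a] unfolding sound_def sq_less_iff by blast
qed (use assms in \<open>auto intro: bexI[of _ x]\<close>)

lemma Lev_below:
  assumes "x \<in> Lev a" "is_seq y" "sq_le y x"
  shows "y \<in> Lev (fst y)"
  using Lev_restr[OF assms(1), of "fst y"] restr_eqI[OF assms(2,3) refl] sq_le_fst[OF assms(3)]
    Lev_fst[OF assms(1)] by simp

lemma Lev_eq:
  assumes "x \<in> Lev a" "y \<in> Lev a" "sq_le x y"
  shows "x = y"
  using sq_le_antisym[OF Lev_is_seq[OF assms(1)] Lev_is_seq[OF assms(2)] assms(3)]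
    assms(1,2)[THEN Lev_fst] by simp

text \<open>A non-glued step depends only on the node reached, not on the start. So a branch can be
  restarted at any later level in \<open>C a\<close>, and a tuple of branches can be given a common
  starting level.\<close>

lemma climb_climb:
  assumes a: "is_limit a" and x: "x \<in> Tree" "fst x \<in> C a"
    and g: "g \<in> C a" "fst x \<le> g" and b: "b \<in> C a \<or> b = a" "g \<le> b"
  shows "climb (C a) b (climb (C a) g x) = climb (C a) b x"
  using b
proof (induction b rule: less_induct)
  case (less b)
  note props = climb_props[OF a sound]
  define y where "y = climb (C a) g x"
  have y: "y \<in> Lev g" unfolding y_def using props[OF x _ g(2)] g(1) C_subset[OF a] by blast
  then have yT: "y \<in> Tree" "fst y \<in> C a" "fst y = g"
    using Lev_fst[OF y] g(1) by (auto simp: Tree_iff)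
  show ?case
  proof (cases "b = g")
    case True
    then show ?thesis using yT(3) by (simp add: branch_below flip: y_def)
  next
    case False
    then have gb: "g < b" using less.prems by simp
    show ?thesis
    proof (cases "is_sup (C a \<inter> oless b) b")
      case True
      have px: "is_seq (climb (C a) b x)" "fst (climb (C a) b x) = b"
        "\<And>d. d \<in> C a \<Longrightarrow> d \<le> b \<Longrightarrow> sq_le (climb (C a) d x) (climb (C a) b x)"
        using props[OF x less.prems(1)] g(2) gb by auto
      have py: "is_seq (climb (C a) b y)" "fst (climb (C a) b y) = b"
        "\<And>d. d \<in> C a \<Longrightarrow> d \<le> b \<Longrightarrow> sq_le (climb (C a) d y) (climb (C a) b y)"
        using props[OF yT(1,2) less.prems(1)] yT(3) gb by auto
      have "climb (C a) b y = climb (C a) b x"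
      \<comment> \<open>The glued families differ below \<open>g\<close>, so the value at
        \<open>u\<close> is compared at some \<open>d\<close> in \<open>C a\<close> beyond both
        \<open>u\<close> and \<open>g\<close>.\<close>
      proof (rule is_seq_eqI[OF py(1) px(1)])
        fix u assume "u < fst (climb (C a) b y)"
        then have "max u g < b" using gb py(2) by simp
        then obtain d where d: "d \<in> C a" "d < b" "max u g < d"
          using True unfolding is_sup_def oless_def by blast
        have e: "climb (C a) d y = climb (C a) d x"
          unfolding y_def using less.IH[of d] d by (simp add: less_imp_le)
        have "fst (climb (C a) d x) = d" using props[OF x, of d] d g(2) by auto
        then have ud: "u < fst (climb (C a) d x)" using d(3) by simp
        have "snd (climb (C a) b y) u = snd (climb (C a) d x) u"
          using py(3)[OF d(1) less_imp_le[OF d(2)]] ud unfolding sq_le_def e by simp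
        also have "\<dots> = snd (climb (C a) b x) u"
          using px(3)[OF d(1) less_imp_le[OF d(2)]] ud unfolding sq_le_def by simp
        finally show "snd (climb (C a) b y) u = snd (climb (C a) b x) u" .
      qed (simp add: px py)
      then show ?thesis unfolding y_def .
    next
      case False
      have ba: "b \<le> a" using less.prems(1) C_subset[OF a] by (auto intro: less_imp_le)
      note pred = pred_greatest[OF C_club[OF a] a ba False g(1) gb]
      have "climb (C a) (pred (C a) b) y = climb (C a) (pred (C a) b) x"
        unfolding y_def using less.IH[of "pred (C a) b"] pred g(1) gb by blast
      then show ?thesis
        unfolding y_def[symmetric]
        using branch_step[OF _ False pred(2), of y Tree] branch_step[OF _ False pred(2), of x Tree]
          yT(3) gb g(2) by simp
    qed
  qed
qed

section \<open>Sealing dense open sets of derived trees\<close>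

lemma Lev_lepoll: "Lev a \<lesssim> oless (max oomega a)"
  using sound[of a] by (simp add: sound_def)

lemma Lev_small: "Lev a \<prec> (UNIV :: 'k set)"
  using lesspoll_trans1[OF Lev_lepoll oless_small] .

text \<open>An injection of the level into an initial segment carries tuples of length below
  \<open>c\<close> to \<open>seqs_below\<close>, where the cardinal arithmetic hypothesis applies.
  Tuples of length one (\<open>Q\<close>) are as many as nodes.\<close>

lemma tuples_small: "tuples (Lev a) \<prec> (UNIV :: 'k set)"
proof -
  obtain f where f: "inj_on f (Lev a)" "f ` Lev a \<subseteq> oless (max oomega a)"
    using Lev_lepoll[of a] unfolding lepoll_def by blast
  define P where "P = {(t, x). t < c \<and> x \<in> oless t \<rightarrow>\<^sub>E Lev a}"
  define Q where "Q = {(osucc ozero :: 'k, x) | x. x \<in> oless (osucc ozero :: 'k) \<rightarrow>\<^sub>E Lev a}"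
  have "P \<lesssim> seqs_below (max oomega a) c"
    unfolding lepoll_def
  proof (intro exI conjI)
    show "inj_on (\<lambda>(t, x). (t, \<lambda>j\<in>oless t. f (x j))) P"
    proof (rule inj_onI, clarsimp simp: P_def)
      fix t x y assume x: "x \<in> oless t \<rightarrow>\<^sub>E Lev a" and y: "y \<in> oless t \<rightarrow>\<^sub>E Lev a"
        and eq: "(\<lambda>j\<in>oless t. f (x j)) = (\<lambda>j\<in>oless t. f (y j))"
      show "x = y"
      proof (rule PiE_ext[OF x y])
        fix j assume j: "j \<in> oless t"
        then have "f (x j) = f (y j)" using fun_cong[OF eq, of j] by simp
        then show "x j = y j" by (rule inj_onD[OF f(1)]) (use x y j in auto)
      qed
    qed
    show "(\<lambda>(t, x). (t, \<lambda>j\<in>oless t. f (x j))) ` P \<subseteq> seqs_below (max oomega a) c"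
      using f(2) unfolding P_def seqs_below_def by fastforce
  qed
  then have "P \<prec> (UNIV :: 'k set)" using pow by (rule lesspoll_trans1)
  moreover have "Q \<prec> (UNIV :: 'k set)"
  proof -
    have "Q \<subseteq> (\<lambda>v. (osucc ozero, \<lambda>j\<in>oless (osucc ozero). v)) ` Lev a"
    proof
      fix q assume "q \<in> Q"
      then obtain x where x: "q = (osucc ozero, x)" "x \<in> oless (osucc ozero :: 'k) \<rightarrow>\<^sub>E Lev a"
        unfolding Q_def by blast
      have "j \<in> oless (osucc ozero :: 'k) \<longleftrightarrow> j = ozero" for j
        by (auto simp: oless_def intro: antisym)
      then have "x ozero \<in> Lev a" "x = (\<lambda>j\<in>oless (osucc ozero). x ozero)"
        using x(2) by (auto simp: PiE_def extensional_def Pi_def fun_eq_iff)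
      then show "q \<in> (\<lambda>v. (osucc ozero, \<lambda>j\<in>oless (osucc ozero). v)) ` Lev a"
        unfolding x(1) by (intro image_eqI) auto
    qed
    then show ?thesis using small_subset small_image[OF Lev_small] by blast
  qed
  ultimately have "P \<union> Q \<prec> (UNIV :: 'k set)" by (rule small_Un)
  moreover have "tuples (Lev a) \<subseteq> P \<union> Q"
    unfolding tuples_def P_def Q_def good_def by auto
  ultimately show ?thesis by (rule small_subset)
qed

text \<open>Smallness of the set of tuples ensures that the \<open>SOME\<close> in
  \<open>enum\<close> yields an enumeration of all of them.\<close>

lemma ex_code:
  assumes "p \<in> tuples (Lev a)"
  shows "\<exists>d. code_ht d = a \<and> tup Tree d = p"
proof -
  have "\<exists>g. tuples (Lev a) \<subseteq> range (g :: 'k \<Rightarrow> _)"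
    using tuples_small[of a] unfolding lesspoll_def lepoll_iff by blast
  then have "tuples (Lev a) \<subseteq> range (enum (Lev a))" unfolding enum_def by (rule someI_ex)
  then obtain e where "p = enum (Lev a) e" using assms by blast
  then have "code_ht (pr (a, e)) = a \<and> tup Tree (pr (a, e)) = p"
    using inj_pr by (simp add: code_ht_def tup_def)
  then show ?thesis ..
qed

text \<open>A closure point of \<open>G\<close> lies above codes for all tuples on lower
  levels.\<close>

lemma code_bound:
  obtains G where "\<And>a p. p \<in> tuples (Lev a) \<Longrightarrow> \<exists>d<G a. code_ht d = a \<and> tup Tree d = p"
proof -
  define F where "F a p = (SOME d. code_ht d = a \<and> tup Tree d = p)" for a p
  have F: "code_ht (F a p) = a \<and> tup Tree (F a p) = p" if "p \<in> tuples (Lev a)" for a p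
    unfolding F_def using ex_code[OF that] by (rule someI_ex)
  have "\<exists>u. \<forall>p\<in>tuples (Lev a). F a p < u" for a by (rule small_image_bounded[OF tuples_small])
  then obtain G where G: "\<And>a. \<forall>p\<in>tuples (Lev a). F a p < G a" by metis
  show thesis using that[of G] F G by blast
qed

text \<open>For \<open>t < c\<close> the range of \<open>g\<close> has size below \<open>c\<close>,
  hence is not cofinal in \<open>a\<close>; for length one the single value is the bound.\<close>

lemma good_bounded:
  assumes "good t" "a \<in> E_ge c" "\<And>j. j < t \<Longrightarrow> g j < (a::'k)"
  shows "\<exists>u<a. \<forall>j<t. g j \<le> u"
proof (cases "t < c")
  case True
  have "g ` oless t \<lesssim> oless t" by (rule image_lepoll)
  also have "oless t \<prec> oless c" using True card by (simp add: is_cardinal_def)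
  finally have "\<not> (g ` oless t \<subseteq> oless a \<and> is_sup (g ` oless t) a)"
    using assms(2) unfolding E_ge_def cf_ge_def by blast
  moreover have "g ` oless t \<subseteq> oless a" using assms(3) by (auto simp: oless_def)
  ultimately have "\<not> is_sup (g ` oless t) a" by blast
  then have "\<exists>u<a. \<forall>x\<in>g ` oless t. \<not> u < x"
    unfolding is_sup_def using assms(3) by (auto simp: oless_def less_imp_le)
  then show ?thesis by (auto simp: oless_def not_less)
next
  case False
  then have t: "t = osucc ozero" using assms(1) by (simp add: good_def)
  have "j = ozero" if "j < t" for j using that t by (simp add: antisym)
  then show ?thesis using assms(3)[of ozero] t by (intro exI[of _ "g ozero"]) auto
qed

text \<open>Injectivity makes the index chosen inside \<open>step\<close> unique, so each branch
  receives its own coordinate of the common seal.\<close>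

lemma step_sealed:
  assumes tup: "tup T (guess_ix b) = (t, x)" and z: "\<exists>z. seals T b g z"
    and inj: "inj_on (\<lambda>j. g (x j)) (oless t)"
  shows "\<exists>z. seals T b g z \<and> (\<forall>j<t. step T b g (g (x j)) = z j)"
proof (intro exI conjI allI impI)
  show "seals T b g (SOME z. seals T b g z)" using z by (rule someI_ex)
  fix j assume j: "j < t"
  have "(SOME j'. j' < t \<and> g (x j') = g (x j)) = j"
    using j inj by (intro some_equality) (auto simp: inj_on_def oless_def)
  then show "step T b g (g (x j)) = (SOME z. seals T b g z) j"
    using z j by (auto simp: step_def tup)
qed

definition derived_le :: "'k \<Rightarrow> ('k \<Rightarrow> 'k kseq) \<Rightarrow> ('k \<Rightarrow> 'k kseq) \<Rightarrow> bool" where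
  "derived_le t f h \<longleftrightarrow> (\<forall>j<t. sq_le (f j) (h j))"

lemma derived_le_trans: "derived_le t f g \<Longrightarrow> derived_le t g h \<Longrightarrow> derived_le t f h"
  unfolding derived_le_def using sq_le_trans by blast

lemma derived_le_refl [simp]: "derived_le t f f"
  by (simp add: derived_le_def)

section \<open>A fixed derived tree: structure, dense open sets, antichains\<close>

context
  fixes t b :: 'k and w :: "'k \<Rightarrow> 'k kseq"
  assumes t: "good t" and w: "\<And>j. j < t \<Longrightarrow> w j \<in> Lev b" and inj_w: "inj_on w (oless t)"
begin

abbreviation DT :: "('k \<Rightarrow> 'k kseq) set" where
  "DT \<equiv> derived_tree Tree t w"

lemma t_pos: "ozero < t"
  using t by (simp add: good_def)

lemma derived_tree_iff:
  "f \<in> DT \<longleftrightarrow> f \<in> oless t \<rightarrow>\<^sub>E Lev (derived_ht f) \<and> (\<forall>j<t. sq_le (f j) (w j) \<or> sq_le (w j) (f j))"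
proof -
  have seq: "compat (f j) (w j) \<longleftrightarrow> sq_le (f j) (w j) \<or> sq_le (w j) (f j)"
    if "f j \<in> Lev a" "j < t" for j a
    using compat_iff[OF Lev_is_seq[OF that(1)] Lev_is_seq[OF w[OF that(2)]]] .
  have ht: "fst (f j) = derived_ht f" if "\<exists>g. \<forall>i<t. fst (f i) = g" "j < t" for j
    using that t_pos unfolding derived_ht_def by metis
  have eq: "f \<in> oless t \<rightarrow>\<^sub>E Tree \<and> (\<exists>g. \<forall>i<t. fst (f i) = g) \<longleftrightarrow> f \<in> oless t \<rightarrow>\<^sub>E Lev (derived_ht f)"
  proof
    assume l: "f \<in> oless t \<rightarrow>\<^sub>E Tree \<and> (\<exists>g. \<forall>i<t. fst (f i) = g)"
    then have "f j \<in> Lev (derived_ht f)" if "j \<in> oless t" for j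
      using ht[of j] that Tree_iff[of "f j"] by (auto simp: oless_def)
    then show "f \<in> oless t \<rightarrow>\<^sub>E Lev (derived_ht f)" using l by (auto simp: PiE_def)
  next
    assume r: "f \<in> oless t \<rightarrow>\<^sub>E Lev (derived_ht f)"
    then have "f \<in> oless t \<rightarrow>\<^sub>E Tree" unfolding Tree_def by (auto simp: PiE_def Pi_def)
    moreover have "\<forall>i<t. fst (f i) = derived_ht f"
      using r Lev_fst by (auto simp: oless_def PiE_def Pi_def)
    ultimately show "f \<in> oless t \<rightarrow>\<^sub>E Tree \<and> (\<exists>g. \<forall>i<t. fst (f i) = g)" by blast
  qed
  have "f \<in> DT \<longleftrightarrow> f \<in> oless t \<rightarrow>\<^sub>E Lev (derived_ht f) \<and> (\<forall>j<t. compat (f j) (w j))"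
    unfolding derived_tree_def using eq by blast
  moreover have "f j \<in> Lev (derived_ht f)" if "f \<in> oless t \<rightarrow>\<^sub>E Lev (derived_ht f)" "j < t" for j
    using that by (auto simp: oless_def)
  ultimately show ?thesis using seq by blast
qed

lemma derived_tree_Lev: "f \<in> DT \<Longrightarrow> j < t \<Longrightarrow> f j \<in> Lev (derived_ht f)"
  unfolding derived_tree_iff by (auto simp: oless_def)

lemma derived_tree_tuple: "f \<in> DT \<Longrightarrow> (t, f) \<in> tuples (Lev (derived_ht f))"
  using t unfolding derived_tree_iff tuples_def by simp

lemma derived_tree_level_small: "{f\<in>DT. derived_ht f = a} \<prec> (UNIV :: 'k set)"
proof -
  have "{f\<in>DT. derived_ht f = a} \<subseteq> snd ` tuples (Lev a)"
    using derived_tree_tuple by force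
  then show ?thesis using small_subset small_image[OF tuples_small] by blast
qed

lemma derived_ht_eq: "f \<in> oless t \<rightarrow>\<^sub>E Lev a \<Longrightarrow> derived_ht f = a"
  unfolding derived_ht_def by (rule Lev_fst[OF PiE_oless[OF _ t_pos]])

lemma derived_tree_I:
  assumes "f \<in> oless t \<rightarrow>\<^sub>E Lev a" "\<And>j. j < t \<Longrightarrow> sq_le (f j) (w j) \<or> sq_le (w j) (f j)"
  shows "f \<in> DT" "derived_ht f = a"
  using assms derived_ht_eq[OF assms(1)] by (simp_all add: derived_tree_iff)

lemma derived_le_ht: "derived_le t f h \<Longrightarrow> derived_ht f \<le> derived_ht h"
  using t_pos unfolding derived_le_def derived_ht_def sq_le_def by blast

lemma derived_le_antisym:
  assumes "f \<in> DT" "h \<in> DT" "derived_le t f h" "derived_ht h \<le> derived_ht f"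
  shows "f = h"
proof -
  have ht: "derived_ht f = derived_ht h" using derived_le_ht[OF assms(3)] assms(4) by simp
  have "f \<in> oless t \<rightarrow>\<^sub>E Lev (derived_ht h)" "h \<in> oless t \<rightarrow>\<^sub>E Lev (derived_ht h)"
    using assms(1,2) ht unfolding derived_tree_iff by auto
  then show ?thesis
  proof (rule PiE_ext)
    fix j assume "j \<in> oless t"
    then have j: "j < t" by (simp add: oless_def)
    show "f j = h j"
      using derived_tree_Lev[OF assms(1) j] derived_tree_Lev[OF assms(2) j] assms(3) j unfolding ht derived_le_def
      by (blast intro: Lev_eq)
  qed
qed

lemma derived_le_imp_less:
  assumes "f \<in> DT" "h \<in> DT" "derived_le t f h" "derived_ht f < derived_ht h"
  shows "derived_less t f h"
  using assms derived_tree_Lev[OF assms(1), THEN Lev_fst] derived_tree_Lev[OF assms(2), THEN Lev_fst]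
  unfolding derived_less_def derived_le_def sq_less_iff by auto

lemma derived_tree_restr:
  assumes "f \<in> DT" "a \<le> derived_ht f"
  shows "\<exists>h\<in>DT. derived_ht h = a \<and> derived_le t h f"
proof -
  define h where "h = (\<lambda>j\<in>oless t. restr (f j) a)"
  have fst: "fst (f j) = derived_ht f" if "j < t" for j using derived_tree_Lev[OF assms(1) that] Lev_fst by blast
  have le: "sq_le (h j) (f j)" if "j < t" for j
    using that fst[OF that] assms(2) by (simp add: h_def oless_def sq_le_restr)
  have mem: "h \<in> oless t \<rightarrow>\<^sub>E Lev a"
    using Lev_restr[OF derived_tree_Lev[OF assms(1)] assms(2)] by (auto simp: h_def oless_def)
  have "sq_le (h j) (w j) \<or> sq_le (w j) (h j)" if "j < t" for j
  proof -
    have "sq_le (f j) (w j) \<or> sq_le (w j) (f j)" using assms(1) that unfolding derived_tree_iff by blast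
    then show ?thesis
    proof
      assume "sq_le (f j) (w j)"
      then show ?thesis using le[OF that] sq_le_trans by blast
    next
      assume "sq_le (w j) (f j)"
      then show ?thesis
        \<comment> \<open>Two initial parts of the same node \<open>f j\<close> are
          comparable.\<close>
        using sq_le_below[OF _ le[OF that]] sq_le_below[OF le[OF that]] linear[of "fst (w j)" "fst (h j)"]
        by blast
    qed
  qed
  then show ?thesis using derived_tree_I[OF mem] le unfolding derived_le_def by blast
qed

text \<open>On a suitable level \<open>a\<close>, the branches through a tuple are restarted on one
  level below \<open>a\<close>; a correct guess at a later point of \<open>C a\<close> has then
  forced them above a member of \<open>U\<close>.\<close>

lemma dense_open_level:
  assumes sub: "U \<subseteq> DT" and dense: "\<And>f. f \<in> DT \<Longrightarrow> \<exists>h\<in>U. derived_le t f h"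
    and up: "\<And>f h. f \<in> U \<Longrightarrow> h \<in> DT \<Longrightarrow> derived_le t f h \<Longrightarrow> h \<in> U"
  shows "\<exists>a. \<forall>f\<in>DT. derived_ht f = a \<longrightarrow> f \<in> U"
proof -
  obtain dn where dn: "\<And>f. f \<in> DT \<Longrightarrow> dn f \<in> U \<and> derived_le t f (dn f)"
    using dense by metis
  obtain G where G: "\<And>a p. p \<in> tuples (Lev a) \<Longrightarrow> \<exists>d<G a. code_ht d = a \<and> tup Tree d = p"
    using code_bound by blast
  have "\<exists>u. \<forall>f\<in>{f\<in>DT. derived_ht f = a}. derived_ht (dn f) < u" for a
    by (rule small_image_bounded[OF derived_tree_level_small])
  then obtain K where K: "\<And>f. f \<in> DT \<Longrightarrow> derived_ht (dn f) < K (derived_ht f)" by (simp, metis)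
  \<comment> \<open>\<open>X i\<close> records both \<open>U\<close> and the index \<open>i\<close>
    of a tuple, so one guessed set determines which branches to treat.\<close>
  define codes where "codes = {d. \<exists>f\<in>U. tup Tree d = (t, f) \<and> code_ht d = derived_ht f}"
  define X where "X i = (\<lambda>d. pr (i, d)) ` codes" for i
  \<comment> \<open>At closure points of \<open>M i\<close>, codes of lower tuples, witnesses of
    density above lower tuples and pairs with \<open>i\<close> all stay below.\<close>
  define M where "M i a = max i (max (G a) (max (K a) (pr (i, a))))" for i a
  define H where "H i = {e. X i \<inter> oless e = A e \<and> e \<in> closed_under (M i)}" for i
  have "\<exists>x\<in>H i. u \<le> x" for i u
  proof -
    \<comment> \<open>Adding \<open>u\<close> to the closure function pushes the closure points
      above \<open>u\<close>.\<close>
    have "{e. X i \<inter> oless e = A e} \<inter> closed_under (\<lambda>a. max u (M i a)) \<noteq> {}"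
      using diamond_guess[of "X i"] club_closed_under unfolding stationary_def by blast
    then obtain e where e: "X i \<inter> oless e = A e" "e \<in> closed_under (\<lambda>a. max u (M i a))" by blast
    then have "e \<in> closed_under (M i)" "u \<le> e"
      by (auto simp: closed_under_def less_imp_le)
    then show ?thesis using e(1) unfolding H_def by blast
  qed
  then have "{a\<in>E_ge c. \<forall>i<a. is_sup {e\<in>C a. succ_omega {d\<in>C a. e \<le> d} \<subseteq> H i} a} \<inter>
      closed_under (\<lambda>a. max (osucc a) (max (G a) b)) \<noteq> {}"
    using C_hits[of H] club_closed_under unfolding stationary_def by blast
  \<comment> \<open>Closure makes \<open>a\<close> a limit above \<open>b\<close>, and makes tuples
    on levels below \<open>a\<close> have codes below \<open>a\<close>, so the hitting property
    applies to them.\<close>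
  then obtain a where aE: "a \<in> E_ge c"
    and sup: "\<And>i. i < a \<Longrightarrow> is_sup {e\<in>C a. succ_omega {d\<in>C a. e \<le> d} \<subseteq> H i} a"
    and acl: "a \<in> closed_under (\<lambda>a. max (osucc a) (max (G a) b))" by blast
  have lim: "is_limit a" and Ga: "\<And>e. e < a \<Longrightarrow> G e < a" and ba: "b < a"
    using acl by (auto simp: closed_under_def is_limit_def)
  have "f \<in> U" if f: "f \<in> DT" and fa: "derived_ht f = a" for f
  proof -
    have fL: "f j \<in> Lev a" if "j < t" for j using derived_tree_Lev[OF f that] fa by simp
    then have "\<forall>j. \<exists>x. j < t \<longrightarrow> x \<in> Tree \<and> fst x \<in> C a \<and> f j = climb (C a) a x"
      unfolding Lev_limit[OF lim] by blast
    then obtain xs where xs: "\<And>j. j < t \<Longrightarrow> xs j \<in> Tree \<and> fst (xs j) \<in> C a \<and> f j = climb (C a) a (xs j)"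
      by metis
    \<comment> \<open>Here the cofinality of \<open>a\<close> is used: the starting heights are
      bounded below \<open>a\<close>, and all branches can be restarted at one level
      \<open>g\<close>.\<close>
    obtain u where u: "u < a" "\<And>j. j < t \<Longrightarrow> fst (xs j) \<le> u"
      using good_bounded[OF t aE, of "\<lambda>j. fst (xs j)"] xs C_subset[OF lim] by blast
    obtain g where g: "g \<in> C a" "max u b < g" using C_unbounded[OF lim, of "max u b"] u(1) ba by auto
    have ga: "g < a" using C_subset[OF lim g(1)] .
    define y where "y = (\<lambda>j\<in>oless t. climb (C a) g (xs j))"
    have xg: "fst (xs j) \<le> g" if "j < t" for j
      using order_trans[OF u(2)[OF that], of g] g(2) by (simp add: less_imp_le)
    have yj: "y j = climb (C a) g (xs j)" if "j < t" for j using that by (simp add: y_def oless_def)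
    have yL: "y j \<in> Lev g" if "j < t" for j
      using climb_props[OF lim sound, of "xs j" g] xs[OF that] xg[OF that] g(1) ga yj[OF that] by simp
    have yT: "y j \<in> Tree" "fst (y j) = g" if "j < t" for j
      using Lev_fst[OF yL[OF that]] yL[OF that] by (auto simp: Tree_iff)
    have fy: "f j = climb (C a) a (y j)" if "j < t" for j
      using climb_climb[OF lim, of "xs j" g a] xs[OF that] xg[OF that] g(1) ga yj[OF that] by simp
    have yclimb: "climb (C a) e (y j) \<in> Lev e" "sq_le (climb (C a) e (y j)) (f j)"
      "sq_le (y j) (climb (C a) e (y j))"
      if "j < t" "e \<in> C a" "g \<le> e" for j e
    proof -
      note ea = C_subset[OF lim that(2)]
      show "climb (C a) e (y j) \<in> Lev e"
        using climb_props[OF lim sound yT(1)[OF that(1)], of e] yT(2)[OF that(1)] g(1) that ea by simp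
      show "sq_le (climb (C a) e (y j)) (f j)"
        using climb_props[OF lim sound yT(1)[OF that(1)], of a] yT(2)[OF that(1)] g(1) ga that ea
          fy[OF that(1)] by simp
      show "sq_le (y j) (climb (C a) e (y j))"
        using sq_le_climb[OF lim sound yT(1)[OF that(1)], of e] yT(2)[OF that(1)] g(1) that by simp
    qed
    have wy: "sq_le (w j) (y j)" if "j < t" for j
    proof (rule sq_le_below)
      have "sq_le (f j) (w j) \<or> sq_le (w j) (f j)" using f that unfolding derived_tree_iff by blast
      then show "sq_le (w j) (f j)"
        using sq_le_fst[of "f j" "w j"] Lev_fst[OF w[OF that]] Lev_fst[OF fL[OF that]] ba by auto
      show "sq_le (y j) (f j)" using yclimb(2)[OF that g(1)] yclimb(3)[OF that g(1)] sq_le_trans by blast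
      show "fst (w j) \<le> fst (y j)" using Lev_fst[OF w[OF that]] yT(2)[OF that] g(2)
        by (simp add: less_imp_le)
    qed
    have "(t, y) \<in> tuples (Lev g)" using t yL by (auto simp: tuples_def y_def oless_def)
    from G[OF this] obtain i where i: "i < G g" "code_ht i = g" "tup Tree i = (t, y)" by blast
    have ia: "i < a" using i(1) Ga[OF ga] by simp
    obtain e where e: "e \<in> C a" "g < e" "succ_omega {d\<in>C a. e \<le> d} \<subseteq> H i"
      using sup[OF ia] ga unfolding is_sup_def by blast
    have ea: "e < a" using C_subset[OF lim e(1)] .
    \<comment> \<open>Of the points of \<open>succ_omega\<close> only the first, the successor
      \<open>s\<close> of \<open>e\<close> in \<open>C a\<close>, is taken; the guess is correct
      there.\<close>
    define s where "s = (LEAST d. d \<in> C a \<and> e < d)"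
    have s: "s \<in> C a" "e < s"
      using LeastI_ex[of "\<lambda>d. d \<in> C a \<and> e < d"] C_unbounded[OF lim ea] unfolding s_def by blast+
    have gap: "d \<le> e" if "d \<in> C a" "d < s" for d
      using not_less_Least[of d "\<lambda>d. d \<in> C a \<and> e < d"] that unfolding s_def by auto
    have "{d\<in>C a. e \<le> d} \<inter> oless s = {e}"
      using gap e(1) s(2) by (auto simp: oless_def intro: antisym)
    then have "s \<in> succ_omega {d\<in>C a. e \<le> d}"
      using s by (simp add: succ_omega_def less_imp_le)
    then have As: "X i \<inter> oless s = A s" and scl: "s \<in> closed_under (M i)"
      using e(3) unfolding H_def by auto
    have sa: "s < a" using C_subset[OF lim s(1)] .
    have nsup: "\<not> is_sup (C a \<inter> oless s) s"
      using gap s(2) unfolding is_sup_def oless_def by (auto simp: not_less)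
    have pred: "pred (C a) s = e"
      using pred_greatest[OF C_club[OF lim] lim less_imp_le[OF sa] nsup e(1) s(2)] gap e(1) s(2)
      by (meson antisym)
    have cl: "G d < s" "K d < s" "pr (i, d) < s" if "d < s" for d
      using scl that by (auto simp: closed_under_def M_def)
    have gs: "g < s" using e(2) s(2) by simp
    define v where "v = (\<lambda>j\<in>oless t. climb (C a) e (y j))"
    have vj: "v j = climb (C a) e (y j)" if "j < t" for j using that by (simp add: v_def oless_def)
    have ge: "g \<le> e" using e(2) by simp
    have wv: "sq_le (w j) (v j)" if "j < t" for j
      using sq_le_trans[OF wy[OF that] yclimb(3)[OF that e(1) ge]] vj[OF that] by simp
    have vL: "v \<in> oless t \<rightarrow>\<^sub>E Lev e"
      using yclimb(1)[OF _ e(1) ge] by (auto simp: v_def oless_def)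
    have v: "v \<in> DT" "derived_ht v = e" using derived_tree_I[OF vL] wv by blast+
    \<comment> \<open>The nodes \<open>climb (C a) e (y j)\<close> lie above the distinct nodes
      \<open>w j\<close> of one level.\<close>
    have inj: "inj_on (\<lambda>j. climb (C a) e (y j)) (oless t)"
    proof (rule inj_onI)
      fix j j' assume "j \<in> oless t" "j' \<in> oless t" and eq: "climb (C a) e (y j) = climb (C a) e (y j')"
      then have j: "j < t" "j' < t" by (auto simp: oless_def)
      have "sq_le (w j) (w j')"
        using wv[OF j(1)] wv[OF j(2)] Lev_fst[OF w[OF j(1)]] Lev_fst[OF w[OF j(2)]] eq
        by (intro sq_le_below[of "w j" "v j" "w j'"]) (auto simp: vj j)
      then have "w j = w j'" using Lev_eq w j by blast
      then show "j = j'" using inj_w j by (auto simp: inj_on_def oless_def)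
    qed
    \<comment> \<open>Density gives a member of \<open>U\<close> above \<open>v\<close>, and closure
      under \<open>K\<close> keeps its height below \<open>s\<close>, so that it can be extended to
      level \<open>s\<close>.\<close>
    define h where "h = dn v"
    have h: "h \<in> U" "derived_le t v h" using dn[OF v(1)] by (auto simp: h_def)
    have hs: "derived_ht h < s" using K[OF v(1)] v(2) cl(2)[OF s(2)] by (simp add: h_def)
    have hDT: "h \<in> DT" using h(1) sub by blast
    obtain d where d: "d < G (derived_ht h)" "code_ht d = derived_ht h" "tup Tree d = (t, h)"
      using G[OF derived_tree_tuple[OF hDT]] by blast
    have "pr (i, d) < s" using d(1) cl(1)[OF hs] cl(3) by simp
    then have prA: "pr (i, d) \<in> A s"
      using h(1) d(2,3) As by (auto simp: X_def codes_def oless_def)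
    \<comment> \<open>Every element of \<open>A s\<close> has the form \<open>pr (i, d')\<close>, so
      the least one yields the index \<open>i\<close>.\<close>
    have "(LEAST x. x \<in> A s) \<in> A s" using prA by (rule LeastI)
    then obtain d' where "(LEAST x. x \<in> A s) = pr (i, d')" using As by (auto simp: X_def)
    then have ix: "guess_ix s = i" using inj_pr by (simp add: guess_ix_def)
    have tup_i: "tup (trunc Tree s) (guess_ix s) = (t, y)"
      using i(2,3) gs by (simp add: ix tup_trunc)
    have "\<forall>j. \<exists>x. j < t \<longrightarrow> x \<in> Lev s \<and> sq_le (h j) x"
      using Lev_extend[OF derived_tree_Lev[OF hDT] less_imp_le[OF hs]] by blast
    then obtain z where z: "\<And>j. j < t \<Longrightarrow> z j \<in> Lev s \<and> sq_le (h j) (z j)" by metis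
    have "seals (trunc Tree s) s (climb (C a) e) z"
    proof -
      have "sq_less (climb (C a) e (y j)) (z j)" if "j < t" for j
      proof -
        have "sq_le (v j) (z j)" using h(2) z[OF that] sq_le_trans that unfolding derived_le_def by blast
        moreover have "fst (v j) = e" using derived_tree_Lev[OF v(1) that] v(2) Lev_fst by blast
        ultimately show ?thesis
          using Lev_fst[of "z j" s] z[OF that] s(2) vj[OF that] by (simp add: sq_less_iff)
      qed
      moreover have "d \<in> guess_set s" using prA d(2) hs by (simp add: guess_set_def ix)
      moreover have "tup (trunc Tree s) d = (t, h)" using d(2,3) hs by (simp add: tup_trunc)
      ultimately show ?thesis
        using z unfolding seals_def tup_i Let_def by (auto simp: level_trunc intro!: bexI[of _ d])
    qed
    \<comment> \<open>The previous \<open>z\<close> only showed that a seal exists; from here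
      \<open>z\<close> is the seal that \<open>step\<close> actually chose.\<close>
    then obtain z where zs: "seals (trunc Tree s) s (climb (C a) e) z"
      and zstep: "\<And>j. j < t \<Longrightarrow> step (trunc Tree s) s (climb (C a) e) (climb (C a) e (y j)) = z j"
      using step_sealed[OF tup_i _ inj] by blast
    have zf: "sq_le (z j) (f j)" if "j < t" for j
    proof -
      have "climb (C a) s (y j) = z j"
        using branch_step[of "y j" s "C a" Tree] nsup yT(2)[OF that] gs s(2) zstep[OF that]
        by (simp add: pred)
      then show ?thesis using yclimb(2)[OF that s(1) less_imp_le[OF gs]] by simp
    qed
    obtain d where d: "d \<in> guess_set s" "fst (tup (trunc Tree s) d) = t"
      "\<And>j. j < t \<Longrightarrow> sq_le (snd (tup (trunc Tree s) d) j) (z j)"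
      using zs unfolding seals_def tup_i by auto
    \<comment> \<open>Correctness of the guess turns the code witnessing the seal back into a member
      of \<open>U\<close>.\<close>
    have ds: "code_ht d < s" and "pr (i, d) \<in> X i"
      using d(1) As by (auto simp: guess_set_def ix)
    then have "d \<in> codes" by (auto simp: X_def dest: injD[OF inj_pr])
    then obtain f' where f': "f' \<in> U" "tup Tree d = (t, f')" unfolding codes_def by blast
    have "derived_le t f' f"
      using d(3) zf f'(2) sq_le_trans unfolding derived_le_def by (simp add: tup_trunc[OF less_imp_le[OF ds]]) blast
    then show "f \<in> U" using up f'(1) f by blast
  qed
  then show ?thesis by blast
qed

text \<open>The set \<open>U\<close> is dense and upward closed, so some level \<open>a\<close> lies
  inside it. If \<open>h\<close> in \<open>B\<close> were higher than \<open>a\<close>, its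
  restriction to \<open>a\<close> would be above some \<open>h'\<close> in \<open>B\<close>; the
  antichain property gives \<open>h' = h\<close>, contradicting the heights.\<close>

lemma derived_tree_antichain_small:
  assumes B: "B \<subseteq> DT" and anti: "\<forall>x\<in>B. \<forall>y\<in>B. x \<noteq> y \<longrightarrow> \<not> derived_less t x y \<and> \<not> derived_less t y x"
  shows "B \<prec> (UNIV :: 'k set)"
proof -
  define U where "U = {f\<in>DT. (\<exists>h\<in>B. derived_le t h f) \<or> \<not> (\<exists>h\<in>B. derived_le t f h)}"
  have eq: "f = h" if "f \<in> B" "h \<in> B" "derived_le t f h" for f h
  proof (cases "derived_ht f < derived_ht h")
    case True
    then show ?thesis using derived_le_imp_less[of f h] that B anti by blast
  next
    case False
    then show ?thesis using derived_le_antisym[OF _ _ that(3)] that B by (auto simp: not_less)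
  qed
  have "\<exists>a. \<forall>f\<in>DT. derived_ht f = a \<longrightarrow> f \<in> U"
  proof (rule dense_open_level)
    show "U \<subseteq> DT" by (auto simp: U_def)
    show "\<exists>h\<in>U. derived_le t f h" if f: "f \<in> DT" for f
    proof (cases "\<exists>h\<in>B. derived_le t f h")
      case True
      then obtain h where "h \<in> B" "derived_le t f h" by blast
      then show ?thesis using B derived_le_refl[of t h] unfolding U_def by blast
    next
      case False
      then show ?thesis using f unfolding U_def by (intro bexI[of _ f]) auto
    qed
    show "h \<in> U" if "f \<in> U" "h \<in> DT" "derived_le t f h" for f h
      using that derived_le_trans unfolding U_def by blast
  qed
  then obtain a where a: "\<And>f. f \<in> DT \<Longrightarrow> derived_ht f = a \<Longrightarrow> f \<in> U" by blast
  have "derived_ht h \<le> a" if h: "h \<in> B" for h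
  proof (rule ccontr)
    assume "\<not> derived_ht h \<le> a"
    then have ah: "a < derived_ht h" by simp
    then obtain f where f: "f \<in> DT" "derived_ht f = a" "derived_le t f h"
      using derived_tree_restr[OF subsetD[OF B h] less_imp_le[OF ah]] by blast
    then have "f \<in> U" using a by blast
    then obtain h' where h': "h' \<in> B" "derived_le t h' f" using f(3) h unfolding U_def by blast
    then have "h' = h" using eq h derived_le_trans[OF h'(2) f(3)] by blast
    then show False using derived_le_ht[OF h'(2)] f(2) ah by simp
  qed
  then have "B \<subseteq> (\<Union>x\<in>oless (osucc a). {f\<in>DT. derived_ht f = x})"
    using B by (auto simp: oless_def)
  then show ?thesis by (rule small_subset[OF small_UN[OF oless_small derived_tree_level_small]])
qed

lemma derived_tree_unbounded: "\<exists>f\<in>DT. a \<le> derived_ht f"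
proof -
  have "\<forall>j. \<exists>x. j < t \<longrightarrow> x \<in> Lev (max a b) \<and> sq_le (w j) x"
    using Lev_extend[OF w, of _ "max a b"] max.cobounded2 by blast
  then obtain z where z: "\<And>j. j < t \<Longrightarrow> z j \<in> Lev (max a b) \<and> sq_le (w j) (z j)" by metis
  have "restrict z (oless t) \<in> oless t \<rightarrow>\<^sub>E Lev (max a b)" using z by (auto simp: oless_def)
  from derived_tree_I[OF this] z show ?thesis by (intro bexI[of _ "restrict z (oless t)"]) (auto simp: oless_def)
qed

end

section \<open>The tree itself and the Souslin properties\<close>

lemma Tree_antichain_small:
  assumes B: "B \<subseteq> Tree" and anti: "\<forall>x\<in>B. \<forall>y\<in>B. x \<noteq> y \<longrightarrow> \<not> sq_less x y \<and> \<not> sq_less y x"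
  shows "B \<prec> (UNIV :: 'k set)"
proof -
  define t where "t = (osucc ozero :: 'k)"
  have good: "good t" and t0: "ozero < t" by (simp_all add: good_def t_def)
  have one: "j = ozero" if "j < t" for j using that by (simp add: t_def antisym)
  have root: "root \<in> Lev ozero" by (simp add: Lev_ozero)
  have inj: "inj_on (\<lambda>_. root) (oless t)" using one by (auto simp: inj_on_def oless_def)
  \<comment> \<open>Nodes become tuples of length one in the derived tree above the root.\<close>
  define E where "E = (\<lambda>x. \<lambda>j\<in>oless t. x) ` B"
  have "E \<prec> (UNIV :: 'k set)"
  proof (rule derived_tree_antichain_small[OF good root inj])
    show "E \<subseteq> derived_tree Tree t (\<lambda>_. root)"
    proof
      fix f assume "f \<in> E"
      then obtain x where x: "x \<in> B" "f = (\<lambda>j\<in>oless t. x)" unfolding E_def by blast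
      then have "x \<in> Lev (fst x)" using B Tree_iff by blast
      moreover have "sq_le root x" by (simp add: sq_le_def root_def)
      ultimately show "f \<in> derived_tree Tree t (\<lambda>_. root)"
        unfolding x(2) by (intro derived_tree_I(1)[OF good root inj, of _ "fst x"]) (auto simp: oless_def)
    qed
    show "\<forall>x\<in>E. \<forall>y\<in>E. x \<noteq> y \<longrightarrow> \<not> derived_less t x y \<and> \<not> derived_less t y x"
      using anti t0 unfolding E_def derived_less_def by (force simp: oless_def)
  qed
  then have "(\<lambda>f. f ozero) ` E \<prec> (UNIV :: 'k set)" by (rule small_image)
  moreover have "(\<lambda>f. f ozero) ` E = B" unfolding E_def image_image using t0 by (simp add: oless_def)
  ultimately show ?thesis by simp
qed

text \<open>Splitting off a side node at every level turns a cofinal branch into an antichain of size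
  $\kappa$.\<close>

lemma Tree_no_cofinal_chain:
  assumes B: "B \<subseteq> Tree" and chain: "\<forall>x\<in>B. \<forall>y\<in>B. x = y \<or> sq_less x y \<or> sq_less y x"
    and unb: "\<forall>a::'k. \<exists>x\<in>B. a \<le> fst x"
  shows False
proof -
  have "\<exists>x\<in>B. a < fst x" for a using unb[rule_format, of "osucc a"] by simp
  then obtain X where X: "\<And>a. X a \<in> B" "\<And>a. a < fst (X a)" by metis
  \<comment> \<open>The value \<open>v a\<close> is one of the two least ordinals and differs from
    the branch at \<open>a\<close>; both are below \<open>oomega\<close>, so the side node
    \<open>u a\<close> is in the tree.\<close>
  define v where "v a = (if snd (X a) a = ozero then osucc ozero else ozero :: 'k)" for a
  define u where "u a = concat1 (restr (X a) a) (v a)" for a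
  have "osucc ozero \<noteq> (ozero :: 'k)" using less_imp_neq[OF ozero_less_osucc] by metis
  then have v: "v a \<noteq> snd (X a) a" for a by (simp add: v_def)
  have "v a < max oomega a" for a
    using osucc_less_oomega[OF ozero_less_oomega] by (simp add: v_def less_max_iff_disj)
  moreover have "restr (X a) a \<in> Lev a" for a
    using Lev_restr[of "X a" "fst (X a)" a] X B Tree_iff less_imp_le by blast
  ultimately have uL: "u a \<in> Lev (osucc a)" for a unfolding u_def Lev_osucc by blast
  have agree: "snd (X a) d = snd (X a') d" if "d < fst (X a)" "d < fst (X a')" for a a' d
    using chain[rule_format, OF X(1) X(1), of a a'] that unfolding sq_less_def by auto
  have "\<not> sq_less (u a) (u a')" for a a'
  proof
    assume l: "sq_less (u a) (u a')"
    then have aa: "a < a'" using Lev_fst[OF uL[of a]] Lev_fst[OF uL[of a']] unfolding sq_less_def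
      by (simp add: not_le[symmetric])
    have "snd (u a) a = snd (u a') a" using l Lev_fst[OF uL[of a]] unfolding sq_less_def by simp
    \<comment> \<open>Below \<open>a'\<close> the node \<open>u a'\<close> follows the branch,
      whereas \<open>u a\<close> leaves it at \<open>a\<close>.\<close>
    then have "v a = snd (X a') a" using aa less_imp_neq[OF aa] by (simp add: u_def concat1_def restr_def oless_def)
    also have "\<dots> = snd (X a) a" using agree[of a a a'] X(2)[of a] less_trans[OF aa X(2)[of a']] by simp
    finally show False using v by blast
  qed
  then have "range u \<prec> (UNIV :: 'k set)"
    using uL by (intro Tree_antichain_small) (unfold Tree_def, blast+)
  then have "fst ` range u \<prec> (UNIV :: 'k set)" by (rule small_image)
  moreover have "fst ` range u = range (osucc :: 'k \<Rightarrow> 'k)"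
    using Lev_fst[OF uL] by (auto simp: image_image)
  ultimately show False
    using small_imp_bounded[of "range (osucc :: 'k \<Rightarrow> 'k)"] less_osucc less_asym by (metis rangeI)
qed

lemma souslin_Tree: "souslin Tree sq_less (fst :: 'k kseq \<Rightarrow> 'k)"
  unfolding souslin_def
proof (intro conjI allI impI)
  fix a :: 'k
  show "\<exists>x\<in>Tree. a \<le> fst x"
    using Lev_extend[of root ozero a] Lev_fst by (fastforce simp: Lev_ozero Tree_iff)
  show "{x \<in> Tree. fst x = a} \<prec> (UNIV :: 'k set)"
    using Lev_small[of a] level_Tree[of a] by (simp add: level_def)
next
  show "\<not> (\<exists>B\<subseteq>Tree. (\<forall>x\<in>B. \<forall>y\<in>B. x = y \<or> sq_less x y \<or> sq_less y x) \<and>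
      (\<forall>a::'k. \<exists>x\<in>B. a \<le> fst x))"
    using Tree_no_cofinal_chain by blast
next
  fix B :: "'k kseq set"
  assume "B \<subseteq> Tree" and "\<forall>x\<in>B. \<forall>y\<in>B. x \<noteq> y \<longrightarrow> \<not> sq_less x y \<and> \<not> sq_less y x"
  then show "B \<prec> (UNIV :: 'k set)" by (rule Tree_antichain_small)
qed

lemma souslin_derived_tree:
  assumes "good t" "\<And>j. j < t \<Longrightarrow> w j \<in> Lev b" "inj_on w (oless t)"
  shows "souslin (derived_tree Tree t w) (derived_less t) (derived_ht :: _ \<Rightarrow> 'k)"
  unfolding souslin_def
proof (intro conjI allI impI)
  fix a :: 'k
  show "\<exists>f\<in>derived_tree Tree t w. a \<le> derived_ht f"
    by (rule derived_tree_unbounded[OF assms])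
  show "{f \<in> derived_tree Tree t w. derived_ht f = a} \<prec> (UNIV :: 'k set)"
    by (rule derived_tree_level_small[OF assms])
next
  show "\<not> (\<exists>B\<subseteq>derived_tree Tree t w. (\<forall>x\<in>B. \<forall>y\<in>B. x = y \<or> derived_less t x y \<or> derived_less t y x) \<and>
      (\<forall>a::'k. \<exists>x\<in>B. a \<le> derived_ht x))"
  proof safe
    fix B assume B: "B \<subseteq> derived_tree Tree t w"
      and chain: "\<forall>x\<in>B. \<forall>y\<in>B. x = y \<or> derived_less t x y \<or> derived_less t y x"
      and unb: "\<forall>a::'k. \<exists>x\<in>B. a \<le> derived_ht x"
    have t0: "ozero < t" using assms(1) by (simp add: good_def)
    show False
    \<comment> \<open>The coordinate \<open>ozero\<close> projects a cofinal chain of tuples to one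
      of nodes.\<close>
    proof (rule Tree_no_cofinal_chain[of "(\<lambda>f. f ozero) ` B"])
      show "(\<lambda>f. f ozero) ` B \<subseteq> Tree"
      proof
        fix x assume "x \<in> (\<lambda>f. f ozero) ` B"
        then obtain f where f: "x = f ozero" "f \<in> derived_tree Tree t w" using B by blast
        then have "f \<in> oless t \<rightarrow>\<^sub>E Tree" by (simp add: derived_tree_def)
        then show "x \<in> Tree" unfolding f(1) using t0 by (rule PiE_oless)
      qed
      show "\<forall>x\<in>(\<lambda>f. f ozero) ` B. \<forall>y\<in>(\<lambda>f. f ozero) ` B. x = y \<or> sq_less x y \<or> sq_less y x"
      proof (intro ballI, elim imageE)
        fix x y f h
        assume xy: "x = f ozero" "y = h ozero" and fh: "f \<in> B" "h \<in> B"
        then show "x = y \<or> sq_less x y \<or> sq_less y x"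
          using chain[rule_format, OF fh] t0 unfolding derived_less_def xy by blast
      qed
      show "\<forall>a. \<exists>x\<in>(\<lambda>f. f ozero) ` B. a \<le> fst x"
        using unb unfolding derived_ht_def by simp
    qed
  qed
next
  fix B
  assume "B \<subseteq> derived_tree Tree t w"
    and "\<forall>x\<in>B. \<forall>y\<in>B. x \<noteq> y \<longrightarrow> \<not> derived_less t x y \<and> \<not> derived_less t y x"
  with assms show "B \<prec> (UNIV :: 'k set)" by (rule derived_tree_antichain_small)
qed

section \<open>The theorem\<close>

lemma slim_Tree: "slim Tree"
  unfolding slim_def
proof
  fix a :: 'k
  show "level Tree a \<lesssim> oless a \<or> countable (level Tree a)"
  proof (cases "oomega \<le> a")
    case True
    then show ?thesis using Lev_lepoll[of a] by (simp add: max_def)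
  next
    case False
    then have "max oomega a = oomega" by (simp add: max_def)
    then show ?thesis using Lev_lepoll[of a] countable_lepoll[OF countable_oomega, of "Lev a"] by simp
  qed
qed

lemma downward_closed_Tree: "downward_closed_tree Tree"
  unfolding downward_closed_tree_def
  using Lev_is_seq Lev_below by (auto simp: Tree_iff sq_less_iff)

lemma prolific_Tree: "prolific Tree"
proof -
  have "concat1 x i \<in> Tree" if "x \<in> Tree" "i < max oomega (fst x)" for x i
    using that unfolding Tree_iff fst_concat1 Lev_osucc by blast
  then show ?thesis unfolding prolific_def by blast
qed

lemma chi_free_Tree: "chi_free Tree c"
  unfolding chi_free_def
proof (intro allI impI, elim conjE)
  fix t b :: 'k and w :: "'k \<Rightarrow> 'k kseq"
  assume "ozero < t" "t < c" "\<forall>i<t. w i \<in> level Tree b" "inj_on w (oless t)"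
  then show "souslin (derived_tree Tree t w) (derived_less t) (derived_ht :: _ \<Rightarrow> 'k)"
    by (intro souslin_derived_tree) (auto simp: good_def)
qed

end

theorem theorem6p2:
  assumes "regular_uncountable_cardinal_type TYPE('k::wellorder)"
    and "is_cardinal (c::'k)"
    and "\<forall>l::'k. seqs_below l c \<prec> (UNIV :: 'k set)"
    and "P14 (E_ge c)"
  shows "\<exists>T :: 'k kseq set. downward_closed_tree T \<and> prolific T \<and> slim T \<and>
           chi_free T c \<and> souslin T sq_less fst"
proof -
  interpret regular_kappa "TYPE('k)" by unfold_locales (rule assms(1))
  obtain pr :: "'k \<times> 'k \<Rightarrow> 'k" where pr: "inj pr"
    using times_self_lepoll[OF infinite_UNIV] by (auto simp: lepoll_def)
  have "diamond TYPE('k)" using assms(4) unfolding P14_def by (rule conjunct1)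
  then obtain A :: "'k \<Rightarrow> 'k set" where A: "\<And>X. stationary {a. X \<inter> oless a = A a}"
    unfolding diamond_def by blast
  from assms(4)[unfolded P14_def, THEN conjunct2] obtain C :: "'k \<Rightarrow> 'k set" where
    C: "\<forall>a. is_limit a \<longrightarrow> club_in (C a) a" "\<forall>a. \<forall>a'\<in>acc (C a). C a' = C a \<inter> oless a'"
      "\<forall>H :: 'k \<Rightarrow> 'k set. (\<forall>i. \<forall>b. \<exists>x\<in>H i. b \<le> x) \<longrightarrow> stationary {a\<in>E_ge c. \<forall>i<a.
        is_sup {b\<in>C a. succ_omega {d\<in>C a. b \<le> d} \<subseteq> H i} a}"
    by (elim exE conjE)
  interpret tree_construction "TYPE('k)" c C A pr
  proof unfold_locales
    show "is_cardinal c" by (rule assms(2))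
    show "seqs_below l c \<prec> (UNIV :: 'k set)" for l using assms(3) ..
    show "inj pr" by (rule pr)
    show "stationary {a. X \<inter> oless a = A a}" for X by (rule A)
    show "club_in (C a) a" if "is_limit a" for a using C(1) that by blast
    show "C a' = C a \<inter> oless a'" if "a' \<in> acc (C a)" for a' a using C(2) that by blast
    show "stationary {a\<in>E_ge c. \<forall>i<a.
        is_sup {b\<in>C a. succ_omega {d\<in>C a. b \<le> d} \<subseteq> H i} a}"
      if "\<And>i b. \<exists>x\<in>H i. b \<le> x" for H
      using C(3) that by simp
  qed
  show ?thesis
    using downward_closed_Tree prolific_Tree slim_Tree chi_free_Tree souslin_Tree by blast
qed

end
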